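(* Let $S=k_{\mathbf p}[x_1,\dots,x_n]$ be a noncommutative PI skew polynomial ring over a field $k$ of characteristic $0$, with center $Z$, with $p_{ij}=\xi^{b_{ij}}$ for a primitive $\ell$th root of unity $\xi$ ($\ell$ minimal), and let $O$ be the group generated by the conjugation automorphisms $\phi_1,\dots,\phi_n$ (full setting in the context). For a root of unity $p$ let $o(p)$ denote its order. Suppose the orders $\{o(p_{ij})\}_{i<j}$ are pairwise coprime. Then $Z$ is regular. As a consequence, (1) $\mathfrak f_i=\prod_{j}o(p_{ij})=\prod_{j\ne i}o(p_{ij})$ for all $i$; (2) $|O|=\ell^2$.
   Context: Setting: $k$ is a field with $\operatorname{char}k=0$. $\mathbf p=(p_{ij})\in M_n(k)$ is multiplicatively antisymmetric ($p_{ii}=1$, $p_{ji}=p_{ij}^{-1}$) with all $p_{ij}$ roots of unity. $S=k_{\mathbf p}[x_1,\dots,x_n]$ is the $k$-algebra generated by $x_1,\dots,x_n$ with relations $x_jx_i=p_{ij}x_ix_j$, graded by $\deg x_i=1$; $Z$ is its center. $\xi$ is a primitive $\ell$th root of unity and $p_{ij}=\xi^{b_{ij}}$ with integers $b_{ij}$, $b_{ii}=0$, $b_{ji}=-b_{ij}$; $\ell$ is minimal and $\ell>1$ (equivalently $S$ is noncommutative), hence $\gcd(\{b_{ij}\}_{i,j},\ell)=1$. $\phi_i(f)=x_i^{-1}fx_i$, so $\phi_i(x_s)=p_{is}x_s$, and $O=\langle\phi_1,\dots,\phi_n\rangle$. "$Z$ is regular" means that $Z$ is a polynomial ring. $\mathfrak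 f_i=\gcd\{d_i\mid \exists\, d_1,\dots,\widehat{d_i},\dots,d_n\text{ with }x_1^{d_1}\cdots x_i^{d_i}\cdots x_n^{d_n}\in Z\}$ (exponents nonnegative integers). *)

theory Defs
  imports
    "HOL-Algebra.Algebra"
    "HOL-Algebra.Algebraic_Closure_Type"
    "HOL-Library.Poly_Mapping"
begin

text \<open>
  The free monoid on \<open>'n\<close>, written additively so that \<open>'n fmon \<Rightarrow>\<^sub>0 'k\<close>, with the convolution
  product of \<open>Poly_Mapping\<close>, is the free associative algebra over \<open>'k\<close> on the generators \<open>'n\<close>.
\<close>

datatype 'n fmon = Word (letters: "'n list")

instantiation fmon :: (type) monoid_add
begin
definition zero_fmon :: "'a fmon" where "zero_fmon = Word []"
definition plus_fmon :: "'a fmon \<Rightarrow> 'a fmon \<Rightarrow> 'a fmon"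
  where "plus_fmon u v = Word (letters u @ letters v)"
instance by standard (simp_all add: zero_fmon_def plus_fmon_def)
end

type_synonym ('n, 'k) free_alg = "'n fmon \<Rightarrow>\<^sub>0 'k"

definition free_gen :: "'n \<Rightarrow> ('n, 'k::comm_ring_1) free_alg"
  where "free_gen i = Poly_Mapping.single (Word [i]) 1"

definition free_scalar :: "'k::comm_ring_1 \<Rightarrow> ('n, 'k) free_alg"
  where "free_scalar c = Poly_Mapping.single 0 c"

definition skew_relations :: "('n \<Rightarrow> 'n \<Rightarrow> 'k::field) \<Rightarrow> ('n, 'k) free_alg set"
  where "skew_relations p =
    {free_gen j * free_gen i - free_scalar (p i j) * free_gen i * free_gen j | i j. True}"

definition skew_ideal :: "('n \<Rightarrow> 'n \<Rightarrow> 'k::field) \<Rightarrow> ('n, 'k) free_alg set"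
  where "skew_ideal p = Idl\<^bsub>ring_of_type_algebra\<^esub> (skew_relations p)"

text \<open>
  The algebra generated by the \<open>x\<^sub>i\<close> subject to \<open>x\<^sub>j x\<^sub>i = p\<^sub>i\<^sub>j x\<^sub>i x\<^sub>j\<close>. An ideal of the free algebra is
  automatically a subspace, so no separate condition on scalars is needed.
\<close>

definition skew_poly_ring :: "('n \<Rightarrow> 'n \<Rightarrow> 'k::field) \<Rightarrow> ('n, 'k) free_alg set ring"
  where "skew_poly_ring p = ring_of_type_algebra Quot (skew_ideal p)"

definition skew_class :: "('n \<Rightarrow> 'n \<Rightarrow> 'k::field) \<Rightarrow> ('n, 'k) free_alg \<Rightarrow> ('n, 'k) free_alg set"
  where "skew_class p a = skew_ideal p +>\<^bsub>ring_of_type_algebra\<^esub> a"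

definition skew_var :: "('n \<Rightarrow> 'n \<Rightarrow> 'k::field) \<Rightarrow> 'n \<Rightarrow> ('n, 'k) free_alg set"
  where "skew_var p i = skew_class p (free_gen i)"

definition skew_scalar :: "('n \<Rightarrow> 'n \<Rightarrow> 'k::field) \<Rightarrow> 'k \<Rightarrow> ('n, 'k) free_alg set"
  where "skew_scalar p c = skew_class p (free_scalar c)"

text \<open>The ordered monomial \<open>x\<^sub>1\<^bsup>d\<^sub>1\<^esup> \<dots> x\<^sub>n\<^bsup>d\<^sub>n\<^esup>\<close>.\<close>

definition skew_monomial ::
    "('n::{finite,linorder} \<Rightarrow> 'n \<Rightarrow> 'k::field) \<Rightarrow> ('n \<Rightarrow> nat) \<Rightarrow> ('n, 'k) free_alg set"
  where "skew_monomial p d =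
    skew_class p (prod_list (map (\<lambda>i. free_gen i ^ d i) (sorted_list_of_set UNIV)))"

lemma ring_ring_of_type_algebra: "ring (ring_of_type_algebra :: 'a::ring_1 ring)"
proof -
  have "\<exists>y. y + x = 0" for x :: 'a
    by (rule exI[of _ "- x"]) simp
  then show ?thesis
    unfolding ring_of_type_algebra_def
    by (intro ringI abelian_groupI monoidI) (auto simp: algebra_simps)
qed

lemma ring_skew_poly_ring: "ring (skew_poly_ring p)"
proof -
  interpret R: ring "ring_of_type_algebra :: ('n, 'k::field) free_alg ring"
    by (rule ring_ring_of_type_algebra)
  have "ideal (skew_ideal p) ring_of_type_algebra"
    unfolding skew_ideal_def by (rule R.genideal_ideal) (simp add: ring_of_type_algebra_def)
  then show ?thesis
    unfolding skew_poly_ring_def by (rule ideal.quotient_is_ring)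
qed

definition ring_center :: "('a, 'b) ring_scheme \<Rightarrow> 'a set"
  where "ring_center R =
    {z \<in> carrier R. \<forall>a \<in> carrier R. z \<otimes>\<^bsub>R\<^esub> a = a \<otimes>\<^bsub>R\<^esub> z}"

text \<open>The commutative polynomial ring over \<open>'k\<close> in the \<open>m\<close> variables indexed by \<open>{..<m}\<close>.\<close>

definition comm_poly_ring :: "nat \<Rightarrow> ((nat \<Rightarrow>\<^sub>0 nat) \<Rightarrow>\<^sub>0 'k::comm_ring_1) ring"
  where "comm_poly_ring m = ring_of_type_algebra
    \<lparr>carrier := {f. \<forall>t \<in> Poly_Mapping.keys f. Poly_Mapping.keys t \<subseteq> {..<m}}\<rparr>"

text \<open>
  The ring \<open>A\<close>, a \<open>'k\<close>-algebra through the structure map \<open>\<eta>\<close>, is isomorphic as a \<open>'k\<close>-algebra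
  to a polynomial ring in finitely many variables.
\<close>

definition is_polynomial_algebra :: "('a, 'b) ring_scheme \<Rightarrow> ('k::comm_ring_1 \<Rightarrow> 'a) \<Rightarrow> bool"
  where "is_polynomial_algebra A \<eta> \<longleftrightarrow>
    (\<exists>m. \<exists>h \<in> ring_iso (comm_poly_ring m :: ((nat \<Rightarrow>\<^sub>0 nat) \<Rightarrow>\<^sub>0 'k) ring) A.
      \<forall>c. h (Poly_Mapping.single 0 c) = \<eta> c)"

definition center_regular :: "('n \<Rightarrow> 'n \<Rightarrow> 'k::field) \<Rightarrow> bool"
  where "center_regular p \<longleftrightarrow>
    is_polynomial_algebra
      ((skew_poly_ring p)\<lparr>carrier := ring_center (skew_poly_ring p)\<rparr>) (skew_scalar p)"

definition center_gcd :: "('n::{finite,linorder} \<Rightarrow> 'n \<Rightarrow> 'k::field) \<Rightarrow> 'n \<Rightarrow> nat"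
  where "center_gcd p i = Gcd {d i | d. skew_monomial p d \<in> ring_center (skew_poly_ring p)}"

text \<open>
  The automorphism \<open>f \<mapsto> x\<^sub>i\<^sup>-\<^sup>1 f x\<^sub>i\<close>. The inverse lives only in a localization; inside the ring
  the image of \<open>f\<close> is the element \<open>g\<close> with \<open>x\<^sub>i g = f x\<^sub>i\<close> (unique, as \<open>x\<^sub>i\<close> is a nonzerodivisor).
\<close>

definition conj_aut ::
    "('n \<Rightarrow> 'n \<Rightarrow> 'k::field) \<Rightarrow> 'n \<Rightarrow> ('n, 'k) free_alg set \<Rightarrow> ('n, 'k) free_alg set"
  where "conj_aut p i =
    (\<lambda>f \<in> carrier (skew_poly_ring p).
      THE g. g \<in> carrier (skew_poly_ring p) \<and>
        skew_var p i \<otimes>\<^bsub>skew_poly_ring p\<^esub> g = f \<otimes>\<^bsub>skew_poly_ring p\<^esub> skew_var p i)"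

text \<open>
  Generated inside the group of all bijections of the underlying set, of which the automorphism
  group of the ring is a subgroup.
\<close>

definition conj_group ::
    "('n \<Rightarrow> 'n \<Rightarrow> 'k::field) \<Rightarrow> (('n, 'k) free_alg set \<Rightarrow> ('n, 'k) free_alg set) set"
  where "conj_group p = generate (BijGroup (carrier (skew_poly_ring p))) (range (conj_aut p))"

definition root_of_unity :: "'k::field \<Rightarrow> bool"
  where "root_of_unity q \<longleftrightarrow> (\<exists>d>0. q ^ d = 1)"

definition root_order :: "'k::field \<Rightarrow> nat"
  where "root_order q = (LEAST d. 0 < d \<and> q ^ d = 1)"

definition primitive_root_of_unity :: "nat \<Rightarrow> 'k::field \<Rightarrow> bool"
  where "primitive_root_of_unity l q \<longleftrightarrow> root_of_unity q \<and> root_order q = l"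

definition mult_antisymmetric :: "('n \<Rightarrow> 'n \<Rightarrow> 'k::field) \<Rightarrow> bool"
  where "mult_antisymmetric p \<longleftrightarrow> (\<forall>i. p i i = 1) \<and> (\<forall>i j. p j i = inverse (p i j))"

definition exponent_data :: "('n \<Rightarrow> 'n \<Rightarrow> 'k::field) \<Rightarrow> nat \<Rightarrow> 'k \<Rightarrow> ('n \<Rightarrow> 'n \<Rightarrow> int) \<Rightarrow> bool"
  where "exponent_data p l \<xi> b \<longleftrightarrow>
    primitive_root_of_unity l \<xi> \<and> (\<forall>i j. p i j = \<xi> powi b i j) \<and>
    (\<forall>i. b i i = 0) \<and> (\<forall>i j. b j i = - b i j)"

definition minimal_exponent_data ::
    "('n \<Rightarrow> 'n \<Rightarrow> 'k::field) \<Rightarrow> nat \<Rightarrow> 'k \<Rightarrow> ('n \<Rightarrow> 'n \<Rightarrow> int) \<Rightarrow> bool"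
  where "minimal_exponent_data p l \<xi> b \<longleftrightarrow>
    exponent_data p l \<xi> b \<and> (\<forall>l' \<xi>' b'. exponent_data p l' \<xi>' b' \<longrightarrow> l \<le> l')"

text \<open>
  The orders are compared as a family over the pairs \<open>i < j\<close>: two equal orders greater than 1
  at different positions are not allowed.
\<close>

definition orders_pairwise_coprime :: "('n::linorder \<Rightarrow> 'n \<Rightarrow> 'k::field) \<Rightarrow> bool"
  where "orders_pairwise_coprime p \<longleftrightarrow>
    (\<forall>i j s t. i < j \<longrightarrow> s < t \<longrightarrow> (i, j) \<noteq> (s, t) \<longrightarrow>
      coprime (root_order (p i j)) (root_order (p s t)))"

end

theory Submission
  imports Defs "HOL-Number_Theory.Cong"
begin

text \<open>
  Sorting words gives every element of \<open>S\<close> coordinates with respect to the ordered monomials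
  \<open>x\<^sup>d\<close>, and \<open>S\<close> becomes a monoid algebra twisted by a bicharacter. In these coordinates,
  conjugation by \<open>x\<^sup>d\<close> scales \<open>x\<^sup>e\<close> by \<open>\<Prod>\<^sub>i\<^sub>,\<^sub>s p\<^sub>i\<^sub>s\<^bsup>d\<^sub>i e\<^sub>s\<^esup>\<close>, so both \<open>Z\<close> and \<open>O\<close> are governed by the
  homomorphism sending \<open>d\<close> to this character. As the orders are pairwise coprime, a product
  \<open>\<Prod>\<^sub>i p\<^sub>i\<^sub>s\<^bsup>d\<^sub>i\<^esup>\<close> is trivial only if each factor is; hence the character is trivial iff
  \<open>F\<^sub>i = \<Prod>\<^sub>j o(p\<^sub>i\<^sub>j)\<close> divides \<open>d\<^sub>i\<close> for all \<open>i\<close>. Therefore \<open>Z\<close> is the polynomial ring in the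
  \<open>x\<^sub>i\<^bsup>F\<^sub>i\<^esup>\<close> and \<open>O\<close> is the product of the \<open>\<int>/F\<^sub>i\<close>, of order \<open>(\<Prod>\<^sub>i\<^sub><\<^sub>j o(p\<^sub>i\<^sub>j))\<^sup>2\<close>; minimality of \<open>\<ell>\<close>
  identifies \<open>\<ell>\<close> with \<open>\<Prod>\<^sub>i\<^sub><\<^sub>j o(p\<^sub>i\<^sub>j)\<close>.
\<close>

subsection \<open>Additive maps on finitely supported functions\<close>

text \<open>When every \<open>h x\<close> is additive, this is the additive map taking
  \<open>single x a\<close> to \<open>h x a\<close>; the maps below are specified on monomials in
  this way.\<close>

definition pm_extend :: "('a \<Rightarrow> 'b \<Rightarrow> 'c) \<Rightarrow> ('a \<Rightarrow>\<^sub>0 'b::zero) \<Rightarrow> 'c::comm_monoid_add"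
  where "pm_extend h f = (\<Sum>x\<in>Poly_Mapping.keys f. h x (Poly_Mapping.lookup f x))"

lemma pm_extend_superset:
  assumes "\<And>x. h x 0 = 0" "finite A" "Poly_Mapping.keys f \<subseteq> A"
  shows "pm_extend h f = (\<Sum>x\<in>A. h x (Poly_Mapping.lookup f x))"
  unfolding pm_extend_def
  by (rule sum.mono_neutral_left) (use assms in \<open>auto simp: in_keys_iff\<close>)

lemma pm_extend_add:
  fixes h :: "'a \<Rightarrow> 'b::ab_group_add \<Rightarrow> 'c::ab_group_add"
  assumes "\<And>x. Modules.additive (h x)"
  shows "pm_extend h (f + g) = pm_extend h f + pm_extend h g"
proof -
  let ?A = "Poly_Mapping.keys f \<union> Poly_Mapping.keys g"
  have z: "h x 0 = 0" for x
    using assms by (rule additive.zero)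
  have "pm_extend h q = (\<Sum>x\<in>?A. h x (Poly_Mapping.lookup q x))"
    if "Poly_Mapping.keys q \<subseteq> ?A" for q
    using that by (intro pm_extend_superset z) auto
  then show ?thesis
    using Poly_Mapping.keys_add[of f g]
    by (simp add: lookup_add additive.add[OF assms] sum.distrib)
qed

lemma additive_pm_extend:
  assumes "\<And>x. Modules.additive (h x)"
  shows "Modules.additive (pm_extend h)"
  by (rule additive.intro) (rule pm_extend_add[OF assms])

lemma pm_extend_single:
  assumes "h x 0 = 0"
  shows "pm_extend h (Poly_Mapping.single x a) = h x a"
  using assms by (simp add: pm_extend_def)

lemma poly_mapping_sum_single:
  "f = (\<Sum>x\<in>Poly_Mapping.keys f. Poly_Mapping.single x (Poly_Mapping.lookup f x))"
  by (rule poly_mapping_eqI)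
    (simp add: lookup_sum lookup_single when_def in_keys_iff)

text \<open>Testing only on keys of \<open>f\<close> matters: centrality of an element constrains
  only the exponents in its support.\<close>

lemma additive_eqI:
  fixes F G :: "('a \<Rightarrow>\<^sub>0 'b::ab_group_add) \<Rightarrow> 'c::ab_group_add"
  assumes "Modules.additive F" "Modules.additive G"
    and "\<And>x a. x \<in> Poly_Mapping.keys f \<Longrightarrow> F (Poly_Mapping.single x a) = G (Poly_Mapping.single x a)"
  shows "F f = G f"
  by (subst (1 2) poly_mapping_sum_single[of f])
    (simp add: additive.sum[OF assms(1)] additive.sum[OF assms(2)] assms(3))

lemma biadditive_eqI:
  fixes F G :: "('a \<Rightarrow>\<^sub>0 'b::ab_group_add) \<Rightarrow> ('d \<Rightarrow>\<^sub>0 'e::ab_group_add) \<Rightarrow> 'c::ab_group_add"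
  assumes "\<And>g. Modules.additive (\<lambda>f. F f g)" "\<And>f. Modules.additive (F f)"
    and "\<And>g. Modules.additive (\<lambda>f. G f g)" "\<And>f. Modules.additive (G f)"
    and "\<And>x a y b. x \<in> Poly_Mapping.keys f \<Longrightarrow> y \<in> Poly_Mapping.keys g \<Longrightarrow>
      F (Poly_Mapping.single x a) (Poly_Mapping.single y b)
      = G (Poly_Mapping.single x a) (Poly_Mapping.single y b)"
  shows "F f g = G f g"
  by (rule additive_eqI[where F = "\<lambda>f. F f g" and G = "\<lambda>f. G f g"],
      rule assms, rule assms, rule additive_eqI; use assms in blast)

lemma additive_single: "Modules.additive (Poly_Mapping.single x)"
  by (simp add: additive.intro single_add)

lemma additive_single_scale:
  "Modules.additive (\<lambda>a::'a::ring. Poly_Mapping.single x (c * a))"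
  by (simp add: additive.intro ring_distribs single_add)


definition unit_exp :: "'n \<Rightarrow> 'n \<Rightarrow> nat"
  where "unit_exp i k = (if k = i then 1 else 0)"


subsection \<open>The twisted monoid algebra\<close>

context
  fixes p :: "'n::{finite,linorder} \<Rightarrow> 'n \<Rightarrow> 'k::field"
begin

text \<open>The scalar in \<open>x\<^sup>d x\<^sup>e = sort_factor d e \<cdot> x\<^bsup>d + e\<^esup>\<close>.\<close>

definition sort_factor :: "('n \<Rightarrow> nat) \<Rightarrow> ('n \<Rightarrow> nat) \<Rightarrow> 'k"
  where "sort_factor d e = (\<Prod>i\<in>UNIV. \<Prod>j\<in>{..<i}. p j i ^ (d i * e j))"

text \<open>The scalar released on sorting a word: \<open>x_i\<close> must pass every smaller
  \<open>x_j\<close> to its right, and each passage \<open>x_i x_j = p j i x_j x_i\<close> costs one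
  factor \<open>p j i\<close>.\<close>

fun word_factor :: "'n list \<Rightarrow> 'k"
  where "word_factor [] = 1"
  | "word_factor (i # w) = (\<Prod>j\<in>{..<i}. p j i ^ count_list w j) * word_factor w"

text \<open>The conjugation \<open>f \<mapsto> x\<^sup>-\<^sup>e f x\<^sup>e\<close> multiplies \<open>x\<^sup>d\<close> by \<open>commutation_char e d\<close>.\<close>

definition commutation_char :: "('n \<Rightarrow> nat) \<Rightarrow> ('n \<Rightarrow> nat) \<Rightarrow> 'k"
  where "commutation_char e d = (\<Prod>i\<in>UNIV. \<Prod>s\<in>UNIV. p i s ^ (e i * d s))"

definition twisted_mult ::
    "(('n \<Rightarrow> nat) \<Rightarrow>\<^sub>0 'k) \<Rightarrow> (('n \<Rightarrow> nat) \<Rightarrow>\<^sub>0 'k) \<Rightarrow> (('n \<Rightarrow> nat) \<Rightarrow>\<^sub>0 'k)"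
  where "twisted_mult f g =
    pm_extend (\<lambda>d a. pm_extend (\<lambda>e b.
      Poly_Mapping.single (\<lambda>i. d i + e i) (sort_factor d e * a * b)) g) f"

definition twisted_ring :: "(('n \<Rightarrow> nat) \<Rightarrow>\<^sub>0 'k) ring"
  where "twisted_ring = \<lparr>carrier = UNIV, monoid.mult = twisted_mult,
    one = Poly_Mapping.single (\<lambda>_. 0) 1, ring.zero = 0, add = (+)\<rparr>"

definition normal_form :: "('n, 'k) free_alg \<Rightarrow> (('n \<Rightarrow> nat) \<Rightarrow>\<^sub>0 'k)"
  where "normal_form = pm_extend (\<lambda>w a.
    Poly_Mapping.single (count_list (letters w)) (word_factor (letters w) * a))"

lemma sort_factor_add_left:
  "sort_factor (\<lambda>i. d i + d' i) e = sort_factor d e * sort_factor d' e"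
  by (simp add: sort_factor_def ring_distribs power_add prod.distrib)

lemma sort_factor_zero [simp]:
  "sort_factor (\<lambda>_. 0) e = 1" "sort_factor d (\<lambda>_. 0) = 1"
  by (simp_all add: sort_factor_def)

lemma sort_factor_unit_left:
  "sort_factor (unit_exp i) e = (\<Prod>j\<in>{..<i}. p j i ^ e j)"
proof -
  have "sort_factor (unit_exp i) e
      = (\<Prod>k\<in>UNIV. if k = i then \<Prod>j\<in>{..<i}. p j i ^ e j else 1)"
    unfolding sort_factor_def unit_exp_def by (rule prod.cong) auto
  then show ?thesis by simp
qed

lemma count_list_Cons:
  "count_list (i # w) = (\<lambda>k. unit_exp i k + count_list w k)"
  by (auto simp: unit_exp_def)

text \<open>Sorting \<open>u @ v\<close> amounts to sorting \<open>u\<close> and \<open>v\<close>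
  separately and then merging two ordered monomials. This is the multiplicativity of
  \<open>normal_form\<close> on words.\<close>

lemma word_factor_append:
  "word_factor (u @ v)
    = word_factor u * word_factor v * sort_factor (count_list u) (count_list v)"
proof (induction u)
  case Nil
  have "count_list ([] :: 'n list) = (\<lambda>_. 0)" by auto
  then show ?case by simp
next
  case (Cons i u)
  then show ?case
    by (simp only: count_list_Cons sort_factor_add_left sort_factor_unit_left)
      (simp add: power_add prod.distrib)
qed

section \<open>Biadditivity of the twisted product and multiplicativity of sorting\<close>

lemma additive_twisted_mult_left: "Modules.additive (\<lambda>f. twisted_mult f g)"
  unfolding twisted_mult_def
proof (rule additive_pm_extend, rule additive.intro)
  fix d :: "'n \<Rightarrow> nat" and a b :: 'k
  show "pm_extend (\<lambda>e c. Poly_Mapping.single (\<lambda>i. d i + e i) (sort_factor d e * (a + b) * c)) g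
    = pm_extend (\<lambda>e c. Poly_Mapping.single (\<lambda>i. d i + e i) (sort_factor d e * a * c)) g
    + pm_extend (\<lambda>e c. Poly_Mapping.single (\<lambda>i. d i + e i) (sort_factor d e * b * c)) g"
    by (simp add: pm_extend_def ring_distribs single_add sum.distrib)
qed

lemma additive_twisted_mult_right: "Modules.additive (twisted_mult f)"
proof (rule additive.intro)
  fix g h
  show "twisted_mult f (g + h) = twisted_mult f g + twisted_mult f h"
    by (simp add: twisted_mult_def pm_extend_add[OF additive_single_scale])
      (simp add: pm_extend_def sum.distrib)
qed

lemma twisted_mult_single:
  "twisted_mult (Poly_Mapping.single d a) (Poly_Mapping.single e b)
    = Poly_Mapping.single (\<lambda>i. d i + e i) (sort_factor d e * a * b)"
  unfolding twisted_mult_def by (simp add: pm_extend_single pm_extend_def)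

lemma additive_normal_form: "Modules.additive normal_form"
  unfolding normal_form_def by (rule additive_pm_extend) (rule additive_single_scale)

lemma normal_form_single:
  "normal_form (Poly_Mapping.single w a)
    = Poly_Mapping.single (count_list (letters w)) (word_factor (letters w) * a)"
  by (simp add: normal_form_def pm_extend_single)

lemma normal_form_mult: "normal_form (a * b) = twisted_mult (normal_form a) (normal_form b)"
proof (rule biadditive_eqI[where F = "\<lambda>a b. normal_form (a * b)"
      and G = "\<lambda>a b. twisted_mult (normal_form a) (normal_form b)"])
  note add = additive.add[OF additive_normal_form] additive.add[OF additive_twisted_mult_left]
    additive.add[OF additive_twisted_mult_right]
  show "Modules.additive (\<lambda>a. normal_form (a * g))" for g
    by (simp add: additive.intro ring_distribs add)
  show "Modules.additive (\<lambda>a. normal_form (f * a))" for f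
    by (simp add: additive.intro ring_distribs add)
  show "Modules.additive (\<lambda>a. twisted_mult (normal_form a) (normal_form g))" for g
    by (simp add: additive.intro add)
  show "Modules.additive (\<lambda>a. twisted_mult (normal_form f) (normal_form a))" for f
    by (simp add: additive.intro add)
  fix u v :: "'n fmon" and x y :: 'k
  have "count_list (letters u @ letters v)
      = (\<lambda>i. count_list (letters u) i + count_list (letters v) i)"
    by auto
  then show "normal_form (Poly_Mapping.single u x * Poly_Mapping.single v y)
      = twisted_mult (normal_form (Poly_Mapping.single u x)) (normal_form (Poly_Mapping.single v y))"
    by (simp add: mult_single normal_form_single twisted_mult_single plus_fmon_def
        word_factor_append mult_ac)
qed

lemma normal_form_scalar: "normal_form (free_scalar c) = Poly_Mapping.single (\<lambda>_. 0) c"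
proof -
  have "count_list ([] :: 'n list) = (\<lambda>_. 0)" by auto
  then show ?thesis
    by (simp add: free_scalar_def normal_form_single zero_fmon_def)
qed

lemma normal_form_one: "normal_form 1 = Poly_Mapping.single (\<lambda>_. 0) 1"
  using normal_form_scalar[of 1] by (simp add: free_scalar_def)

lemma normal_form_gen:
  "normal_form (free_gen i) = Poly_Mapping.single (unit_exp i) 1"
proof -
  have "count_list [i] = unit_exp i" by (auto simp: unit_exp_def)
  then show ?thesis
    by (simp add: free_gen_def normal_form_single)
qed

end

subsection \<open>The relation ideal as the kernel of sorting\<close>

definition sorted_word :: "('n::{finite,linorder} \<Rightarrow> nat) \<Rightarrow> 'n list"
  where "sorted_word d = concat (map (\<lambda>i. replicate (d i) i) (sorted_list_of_set UNIV))"

lemma count_list_replicate: "count_list (replicate m x) y = (if x = y then m else 0)"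
  by (induction m) auto

lemma count_list_concat_replicate:
  "distinct xs \<Longrightarrow>
    count_list (concat (map (\<lambda>i. replicate (d i) i) xs)) j = (if j \<in> set xs then d j else 0)"
  by (induction xs) (auto simp: count_list_replicate)

lemma count_list_sorted_word [simp]: "count_list (sorted_word d) = d"
  by (auto simp: sorted_word_def count_list_concat_replicate)

lemma sorted_concat_replicate:
  "sorted xs \<Longrightarrow> sorted (concat (map (\<lambda>i. replicate (d i) i) xs))"
  by (induction xs) (auto simp: sorted_append)

lemma sorted_sorted_word: "sorted (sorted_word d)"
  unfolding sorted_word_def by (rule sorted_concat_replicate) simp

lemma word_factor_sorted: "sorted w \<Longrightarrow> word_factor p w = 1"
proof (induction w)
  case (Cons i w)
  then have "j \<notin> set w" if "j < i" for j
    using that by auto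
  then have "(\<Prod>j\<in>{..<i}. p j i ^ count_list w j) = 1"
    by (intro prod.neutral) (auto simp: count_list_0_iff)
  with Cons show ?case by simp
qed simp

text \<open>An additive section of \<open>normal_form\<close>, since a sorted word releases no
  scalar. It yields surjectivity of \<open>normal_form\<close> and a standard representative for
  each class.\<close>

definition lift_normal :: "(('n::{finite,linorder} \<Rightarrow> nat) \<Rightarrow>\<^sub>0 'k::field) \<Rightarrow> ('n, 'k) free_alg"
  where "lift_normal = pm_extend (\<lambda>d a. Poly_Mapping.single (Word (sorted_word d)) a)"

lemma additive_lift_normal: "Modules.additive lift_normal"
  unfolding lift_normal_def by (rule additive_pm_extend) (rule additive_single)

lemma lift_normal_single:
  "lift_normal (Poly_Mapping.single d a) = Poly_Mapping.single (Word (sorted_word d)) a"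
  by (simp add: lift_normal_def pm_extend_single)

lemma normal_form_lift_normal: "normal_form p (lift_normal m) = m"
proof (rule additive_eqI[where F = "\<lambda>m. normal_form p (lift_normal m)" and G = "\<lambda>m. m"])
  show "Modules.additive (\<lambda>m. normal_form p (lift_normal m))"
    by (simp add: additive.intro additive.add[OF additive_normal_form]
        additive.add[OF additive_lift_normal])
  show "Modules.additive (\<lambda>m. m)"
    by (simp add: additive.intro)
qed (simp add: lift_normal_single normal_form_single word_factor_sorted sorted_sorted_word)

lemma prod_list_free_gen_power:
  "prod_list (map (\<lambda>i. free_gen i ^ d i) xs)
    = Poly_Mapping.single (Word (concat (map (\<lambda>i. replicate (d i) i) xs))) (1::'k::field)"
proof (induction xs)
  case Nil
  show ?case by (simp add: zero_fmon_def flip: single_one)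
next
  case (Cons i xs)
  have "free_gen i ^ m = Poly_Mapping.single (Word (replicate m i)) (1::'k)" for m
    by (induction m)
      (auto simp: free_gen_def mult_single plus_fmon_def zero_fmon_def simp flip: single_one)
  with Cons show ?case
    by (simp add: mult_single plus_fmon_def)
qed

lemma ring_of_type_algebra_simps [simp]:
  "carrier ring_of_type_algebra = UNIV"
  "x \<otimes>\<^bsub>ring_of_type_algebra\<^esub> y = x * y"
  "\<one>\<^bsub>ring_of_type_algebra\<^esub> = 1"
  "\<zero>\<^bsub>ring_of_type_algebra\<^esub> = 0"
  "x \<oplus>\<^bsub>ring_of_type_algebra\<^esub> y = x + y"
  by (simp_all add: ring_of_type_algebra_def)

lemma twisted_ring_simps [simp]:
  "carrier (twisted_ring p) = UNIV"
  "x \<otimes>\<^bsub>twisted_ring p\<^esub> y = twisted_mult p x y"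
  "\<one>\<^bsub>twisted_ring p\<^esub> = Poly_Mapping.single (\<lambda>_. 0) 1"
  "\<zero>\<^bsub>twisted_ring p\<^esub> = 0"
  "x \<oplus>\<^bsub>twisted_ring p\<^esub> y = x + y"
  by (simp_all add: twisted_ring_def)

lemma normal_form_ring_hom: "normal_form p \<in> ring_hom ring_of_type_algebra (twisted_ring p)"
  by (rule ring_hom_memI)
    (simp_all add: normal_form_mult normal_form_one additive.add[OF additive_normal_form])

text \<open>The ring axioms, associativity in particular, are inherited from the free algebra,
  because \<open>normal_form p\<close> is additive, multiplicative, unital and onto.\<close>

lemma ring_twisted_ring: "ring (twisted_ring p)"
proof -
  have "normal_form p ` UNIV = UNIV"
    using normal_form_lift_normal[of p] by (metis surjI)
  then have "twisted_ring p = twisted_ring p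
      \<lparr>carrier := normal_form p ` carrier ring_of_type_algebra,
       ring.zero := normal_form p \<zero>\<^bsub>ring_of_type_algebra\<^esub>\<rparr>"
    by (simp add: twisted_ring_def additive.zero[OF additive_normal_form])
  then show ?thesis
    using ring.ring_hom_imp_img_ring[OF ring_ring_of_type_algebra normal_form_ring_hom[of p]]
    by simp
qed

lemma normal_form_ring_hom_ring: "ring_hom_ring ring_of_type_algebra (twisted_ring p) (normal_form p)"
  by (intro ring_hom_ringI2 ring_ring_of_type_algebra ring_twisted_ring normal_form_ring_hom)

context
  fixes p :: "'n::{finite,linorder} \<Rightarrow> 'n \<Rightarrow> 'k::field"
begin

section \<open>Rewriting words modulo the relation ideal\<close>

lemma skew_ideal_ideal: "ideal (skew_ideal p) ring_of_type_algebra"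
  unfolding skew_ideal_def
  by (rule ring.genideal_ideal[OF ring_ring_of_type_algebra]) simp

lemma skew_ideal_mult:
  "x \<in> skew_ideal p \<Longrightarrow> y * x \<in> skew_ideal p" "x \<in> skew_ideal p \<Longrightarrow> x * y \<in> skew_ideal p"
  using ideal.I_l_closed[OF skew_ideal_ideal, of x y] ideal.I_r_closed[OF skew_ideal_ideal, of x y]
  by simp_all

lemma skew_ideal_zero: "0 \<in> skew_ideal p"
  using additive_subgroup.zero_closed[OF ideal.axioms(1)[OF skew_ideal_ideal]] by simp

lemma skew_ideal_add:
  "x \<in> skew_ideal p \<Longrightarrow> y \<in> skew_ideal p \<Longrightarrow> x + y \<in> skew_ideal p"
  using additive_subgroup.a_closed[OF ideal.axioms(1)[OF skew_ideal_ideal], of x y] by simp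

text \<open>The scalar \<open>c\<close> stays anonymous: only the existence of a representative
  supported on sorted words is needed here, and \<open>normal_form\<close> settles uniqueness
  later.\<close>

definition word_equiv :: "'n list \<Rightarrow> 'n list \<Rightarrow> bool"
  where "word_equiv u v \<longleftrightarrow>
    (\<exists>c. Poly_Mapping.single (Word u) 1 - Poly_Mapping.single (Word v) c \<in> skew_ideal p)"

lemma word_equiv_refl: "word_equiv u u"
  unfolding word_equiv_def by (rule exI[of _ 1]) (simp add: skew_ideal_zero)

lemma word_equiv_trans:
  assumes "word_equiv u v" "word_equiv v w"
  shows "word_equiv u w"
proof -
  obtain c c' where
    c: "Poly_Mapping.single (Word u) 1 - Poly_Mapping.single (Word v) c \<in> skew_ideal p" and
    c': "Poly_Mapping.single (Word v) 1 - Poly_Mapping.single (Word w) c' \<in> skew_ideal p"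
    using assms by (auto simp: word_equiv_def)
  \<comment> \<open>Scaling the second congruence by \<open>c\<close> makes its leading term cancel
    the trailing term of the first.\<close>
  have "free_scalar c * (Poly_Mapping.single (Word v) 1 - Poly_Mapping.single (Word w) c')
      = Poly_Mapping.single (Word v) c - Poly_Mapping.single (Word w) (c * c')"
    by (simp add: free_scalar_def right_diff_distrib mult_single)
  then have "Poly_Mapping.single (Word u) 1 - Poly_Mapping.single (Word w) (c * c') \<in> skew_ideal p"
    using skew_ideal_add[OF c skew_ideal_mult(1)[OF c', of "free_scalar c"]] by simp
  then show ?thesis by (auto simp: word_equiv_def)
qed

lemma word_equiv_append:
  assumes "word_equiv u v"
  shows "word_equiv (s @ u @ t) (s @ v @ t)"
proof -
  obtain c where
    "Poly_Mapping.single (Word u) 1 - Poly_Mapping.single (Word v) c \<in> skew_ideal p"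
    using assms by (auto simp: word_equiv_def)
  then have "Poly_Mapping.single (Word s) 1 *
      (Poly_Mapping.single (Word u) 1 - Poly_Mapping.single (Word v) c)
      * Poly_Mapping.single (Word t) 1 \<in> skew_ideal p"
    by (intro skew_ideal_mult)
  then show ?thesis
    by (auto simp: word_equiv_def algebra_simps mult_single plus_fmon_def)
qed

lemma word_equiv_swap: "word_equiv [j, i] [i, j]"
proof -
  have "free_gen j * free_gen i - free_scalar (p i j) * free_gen i * free_gen j \<in> skew_relations p"
    by (auto simp: skew_relations_def)
  moreover have "skew_relations p \<subseteq> skew_ideal p"
    unfolding skew_ideal_def
    using ring.genideal_self[OF ring_ring_of_type_algebra, of "skew_relations p"] by simp
  ultimately have "free_gen j * free_gen i - free_scalar (p i j) * free_gen i * free_gen j \<in> skew_ideal p"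
    by blast
  then show ?thesis
    by (auto simp: word_equiv_def free_gen_def free_scalar_def mult_single plus_fmon_def zero_fmon_def)
qed

lemma word_equiv_move: "word_equiv (a # u @ v) (u @ a # v)"
proof (induction u)
  case Nil
  show ?case by (simp add: word_equiv_refl)
next
  case (Cons b u)
  have "word_equiv ([] @ [a, b] @ (u @ v)) ([] @ [b, a] @ (u @ v))"
    by (rule word_equiv_append[OF word_equiv_swap])
  moreover have "word_equiv ([b] @ (a # u @ v) @ []) ([b] @ (u @ a # v) @ [])"
    by (rule word_equiv_append[OF Cons])
  ultimately show ?case
    using word_equiv_trans by auto
qed

text \<open>Adjacent swaps generate all rearrangements: the tail of \<open>u\<close> is first turned
  into \<open>v\<close> without one copy of the head, then the head is moved into place.\<close>

lemma word_equiv_mset: "mset u = mset v \<Longrightarrow> word_equiv u v"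
proof (induction u arbitrary: v)
  case Nil
  then show ?case by (simp add: word_equiv_refl)
next
  case (Cons a u)
  then have "a \<in> set v"
    by (metis list.set_intros(1) mset_eq_setD)
  then obtain v1 v2 where v: "v = v1 @ a # v2"
    by (auto simp: in_set_conv_decomp)
  with Cons.prems have "word_equiv u (v1 @ v2)"
    by (intro Cons.IH) simp
  then have "word_equiv (a # u) (a # v1 @ v2)"
    using word_equiv_append[of u "v1 @ v2" "[a]" "[]"] by simp
  then show ?case
    using word_equiv_move v word_equiv_trans by blast
qed

lemma word_equiv_sorted_word: "word_equiv u (sorted_word (count_list u))"
proof (rule word_equiv_mset, rule multiset_eqI)
  fix x
  have count: "count (mset w) x = count_list w x" for w :: "'n list"
    by (induction w) auto
  show "count (mset u) x = count (mset (sorted_word (count_list u))) x"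
    by (simp add: count)
qed

text \<open>The spanning half of the monomial basis theorem: each word reduces to a multiple of a
  sorted word, and the ideal is closed under sums.\<close>

lemma ex_lift_normal_cong: "\<exists>m. a - lift_normal m \<in> skew_ideal p"
proof -
  have single: "\<exists>m. Poly_Mapping.single w x - lift_normal m \<in> skew_ideal p" for w x
  proof -
    obtain c where c: "Poly_Mapping.single w 1
        - Poly_Mapping.single (Word (sorted_word (count_list (letters w)))) c \<in> skew_ideal p"
      using word_equiv_sorted_word[of "letters w"] by (auto simp: word_equiv_def)
    have "Poly_Mapping.single w x - lift_normal (Poly_Mapping.single (count_list (letters w)) (x * c))
        \<in> skew_ideal p"
      using skew_ideal_mult(1)[OF c, of "free_scalar x"]
      by (simp add: lift_normal_single free_scalar_def right_diff_distrib mult_single)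
    then show ?thesis by blast
  qed
  have "\<exists>m. (\<Sum>w\<in>A. Poly_Mapping.single w (Poly_Mapping.lookup a w)) - lift_normal m \<in> skew_ideal p"
    if "finite A" for A
    using that
  proof (induction A)
    case empty
    show ?case
      by (rule exI[of _ 0]) (simp add: additive.zero[OF additive_lift_normal] skew_ideal_zero)
  next
    case (insert w A)
    obtain m m' where
      "(\<Sum>w\<in>A. Poly_Mapping.single w (Poly_Mapping.lookup a w)) - lift_normal m \<in> skew_ideal p"
      "Poly_Mapping.single w (Poly_Mapping.lookup a w) - lift_normal m' \<in> skew_ideal p"
      using insert.IH single by blast
    from skew_ideal_add[OF this] insert.hyps
    show ?case
      by (intro exI[of _ "m + m'"])
        (simp add: additive.add[OF additive_lift_normal] algebra_simps)
  qed
  then show ?thesis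
    by (metis finite_keys poly_mapping_sum_single)
qed

text \<open>The independence half: the kernel of \<open>normal_form\<close> is an ideal, so it
  suffices that it contains the defining relations.\<close>

lemma skew_ideal_le_kernel:
  assumes "\<And>i. p i i = 1" "\<And>i j. p i j * p j i = 1" "a \<in> skew_ideal p"
  shows "normal_form p a = 0"
proof -
  note fold = additive.diff[OF additive_normal_form]
  have rel: "normal_form p (free_gen j * free_gen i - free_scalar (p i j) * free_gen i * free_gen j) = 0"
    for i j
  proof -
    have s: "sort_factor p (unit_exp a) (unit_exp b) = (if b < a then p b a else 1)" for a b
      by (simp add: sort_factor_unit_left) (simp add: unit_exp_def if_distrib[of "power _"] cong: if_cong)
    have nf: "normal_form p (free_gen j * free_gen i - free_scalar (p i j) * free_gen i * free_gen j)
        = Poly_Mapping.single (\<lambda>k. unit_exp i k + unit_exp j k) (sort_factor p (unit_exp j) (unit_exp i))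
          - Poly_Mapping.single (\<lambda>k. unit_exp i k + unit_exp j k) (sort_factor p (unit_exp i) (unit_exp j) * p i j)"
      by (simp add: fold normal_form_mult normal_form_gen normal_form_scalar twisted_mult_single
          add.commute)
    \<comment> \<open>Both words of the relation have the same exponent vector, so only scalars are
      compared. The sorting scalar comes from the left word if \<open>i < j\<close>, from the right
      word if \<open>j < i\<close>, and from neither if \<open>i = j\<close>.\<close>
    have "sort_factor p (unit_exp i) (unit_exp j) * p i j = sort_factor p (unit_exp j) (unit_exp i)"
    proof (cases i j rule: linorder_cases)
      case equal
      then show ?thesis using assms(1) by simp
    next
      case less
      then have "\<not> j < i" by simp
      with less show ?thesis by (simp only: s) simp
    next
      case greater
      then have "\<not> i < j" by simp
      with greater show ?thesis using assms(2)[of j i] by (simp only: s) simp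
    qed
    then show ?thesis
      unfolding nf by simp
  qed
  have "skew_ideal p \<subseteq> a_kernel ring_of_type_algebra (twisted_ring p) (normal_form p)"
    unfolding skew_ideal_def
  proof (rule ring.genideal_minimal[OF ring_ring_of_type_algebra
        ring_hom_ring.kernel_is_ideal[OF normal_form_ring_hom_ring]])
    show "skew_relations p \<subseteq> a_kernel ring_of_type_algebra (twisted_ring p) (normal_form p)"
    proof
      fix x assume "x \<in> skew_relations p"
      then have "normal_form p x = 0"
        unfolding skew_relations_def using rel by blast
      then show "x \<in> a_kernel ring_of_type_algebra (twisted_ring p) (normal_form p)"
        by (simp add: a_kernel_def')
    qed
  qed
  with assms(3) have "a \<in> a_kernel ring_of_type_algebra (twisted_ring p) (normal_form p)"
    by blast
  then show ?thesis
    by (simp add: a_kernel_def')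
qed

end

text \<open>The two halves combine: an element of the kernel is congruent to some
  \<open>lift_normal m\<close>, and applying \<open>normal_form\<close> forces
  \<open>m = 0\<close>.\<close>

lemma skew_ideal_eq_kernel:
  assumes "mult_antisymmetric p" "\<And>i j. p i j \<noteq> 0"
  shows "skew_ideal p = a_kernel ring_of_type_algebra (twisted_ring p) (normal_form p)"
proof (intro equalityI subsetI)
  have le: "normal_form p a = 0" if "a \<in> skew_ideal p" for a
    using that
  proof (rule skew_ideal_le_kernel[rotated 2])
    show "p i i = 1" for i
      using assms(1) by (simp add: mult_antisymmetric_def)
    show "p i j * p j i = 1" for i j
    proof -
      have "p j i = inverse (p i j)"
        using assms(1) unfolding mult_antisymmetric_def by blast
      then show ?thesis by (simp add: assms(2))
    qed
  qed
  then show "a \<in> a_kernel ring_of_type_algebra (twisted_ring p) (normal_form p)"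
    if "a \<in> skew_ideal p" for a
    using that by (auto simp: a_kernel_def')
  fix a assume "a \<in> a_kernel ring_of_type_algebra (twisted_ring p) (normal_form p)"
  then have "normal_form p a = 0"
    by (auto simp: a_kernel_def')
  moreover obtain m where m: "a - lift_normal m \<in> skew_ideal p"
    using ex_lift_normal_cong by blast
  ultimately have "m = 0"
    using le[OF m] by (simp add: additive.diff[OF additive_normal_form] normal_form_lift_normal)
  with m show "a \<in> skew_ideal p"
    by (simp add: additive.zero[OF additive_lift_normal])
qed

subsection \<open>Coordinates on the skew polynomial ring\<close>

text \<open>Injectivity of \<open>k\<close> keeps distinct terms from colliding, so coefficients can
  be read off one by one.\<close>

lemma lookup_pm_extend_inj:
  assumes "inj k" "\<And>x. r x 0 = 0"
  shows "Poly_Mapping.lookup (pm_extend (\<lambda>x a. Poly_Mapping.single (k x) (r x a)) f) (k x)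
    = r x (Poly_Mapping.lookup f x)"
proof -
  have "Poly_Mapping.lookup (pm_extend (\<lambda>x a. Poly_Mapping.single (k x) (r x a)) f) (k x)
    = (\<Sum>y\<in>Poly_Mapping.keys f. if y = x then r x (Poly_Mapping.lookup f x) else 0)"
    unfolding pm_extend_def lookup_sum
    by (rule sum.cong) (auto simp: lookup_single when_def inj_eq[OF assms(1)])
  then show ?thesis
    by (simp add: in_keys_iff assms(2))
qed

section \<open>Relabelling of exponents\<close>

abbreviation (input) "rekey k \<equiv> pm_extend (\<lambda>x. Poly_Mapping.single (k x))"

lemma additive_rekey: "Modules.additive (rekey k)"
  by (rule additive_pm_extend) (rule additive_single)

lemma keys_rekey: "Poly_Mapping.keys (rekey k f) \<subseteq> k ` Poly_Mapping.keys f"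
proof -
  have "Poly_Mapping.keys (rekey k f)
      \<subseteq> (\<Union>x\<in>Poly_Mapping.keys f. Poly_Mapping.keys (Poly_Mapping.single (k x) (Poly_Mapping.lookup f x)))"
    unfolding pm_extend_def by (rule keys_sum)
  also have "\<dots> \<subseteq> k ` Poly_Mapping.keys f"
    by auto
  finally show ?thesis .
qed

lemma rekey_inverse:
  fixes f :: "'a \<Rightarrow>\<^sub>0 'b::ab_group_add"
  assumes "\<And>x. x \<in> Poly_Mapping.keys f \<Longrightarrow> k' (k x) = x"
  shows "rekey k' (rekey k f) = f"
  by (rule additive_eqI[where F = "\<lambda>f. rekey k' (rekey k f)" and G = "\<lambda>f. f"])
    (simp_all add: additive.intro additive.add[OF additive_rekey] pm_extend_single assms)

lemma bij_betw_rekey: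
  assumes K: "bij_betw K A B"
  shows "bij_betw (rekey K)
    {f :: 'a \<Rightarrow>\<^sub>0 'b::ab_group_add. Poly_Mapping.keys f \<subseteq> A} {g. Poly_Mapping.keys g \<subseteq> B}"
proof (rule bij_betw_byWitness[where f' = "rekey (inv_into A K)"])
  show "\<forall>f\<in>{f :: _ \<Rightarrow>\<^sub>0 'b. Poly_Mapping.keys f \<subseteq> A}. rekey (inv_into A K) (rekey K f) = f"
    using bij_betw_inv_into_left[OF K] by (intro ballI rekey_inverse) auto
  show "\<forall>f\<in>{f :: _ \<Rightarrow>\<^sub>0 'b. Poly_Mapping.keys f \<subseteq> B}. rekey K (rekey (inv_into A K) f) = f"
    using bij_betw_inv_into_right[OF K] by (intro ballI rekey_inverse) auto
  show "rekey K ` {f :: _ \<Rightarrow>\<^sub>0 'b. Poly_Mapping.keys f \<subseteq> A} \<subseteq> {f. Poly_Mapping.keys f \<subseteq> B}"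
    using keys_rekey bij_betw_imp_surj_on[OF K] by fast
  show "rekey (inv_into A K) ` {f :: _ \<Rightarrow>\<^sub>0 'b. Poly_Mapping.keys f \<subseteq> B} \<subseteq> {f. Poly_Mapping.keys f \<subseteq> A}"
    using keys_rekey bij_betw_imp_surj_on[OF bij_betw_inv_into[OF K]] by fast
qed

locale skew_setting =
  fixes p :: "'n::{finite,linorder} \<Rightarrow> 'n \<Rightarrow> 'k::field"
  assumes antisym: "mult_antisymmetric p"
    and root_of_unity: "root_of_unity (p i j)"
begin

lemma p_nonzero [simp]: "p i j \<noteq> 0"
  using root_of_unity[of i j] by (auto simp: root_of_unity_def power_0_left)

lemma p_diag [simp]: "p i i = 1"
  using antisym by (simp add: mult_antisymmetric_def)

lemma p_swap: "p j i = inverse (p i j)"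
  using antisym unfolding mult_antisymmetric_def by blast

lemma p_mult_swap: "p i j * p j i = 1"
  by (simp add: p_swap[of j i])

abbreviation "S \<equiv> skew_poly_ring p"

text \<open>\<open>normal_form\<close> is constant on the cosets of its kernel, so the image of a
  class is a singleton; \<open>coord\<close> is the map of the first isomorphism theorem.\<close>

definition coord :: "('n, 'k) free_alg set \<Rightarrow> (('n \<Rightarrow> nat) \<Rightarrow>\<^sub>0 'k)"
  where "coord u = the_elem (normal_form p ` u)"

definition from_coord :: "(('n \<Rightarrow> nat) \<Rightarrow>\<^sub>0 'k) \<Rightarrow> ('n, 'k) free_alg set"
  where "from_coord m = skew_class p (lift_normal m)"

lemma coord_ring_iso: "coord \<in> ring_iso S (twisted_ring p)"
proof -
  have "normal_form p ` UNIV = UNIV"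
    using normal_form_lift_normal[of p] by (metis surjI)
  then show ?thesis
    using ring_hom_ring.FactRing_iso_set[OF normal_form_ring_hom_ring[of p]]
    unfolding coord_def[abs_def] skew_poly_ring_def skew_ideal_eq_kernel[OF antisym p_nonzero]
    by simp
qed

lemma skew_class_carrier [simp]: "skew_class p a \<in> carrier S"
  unfolding skew_class_def skew_poly_ring_def
  by (auto simp: FactRing_def A_RCOSETS_def')

lemma coord_skew_class [simp]: "coord (skew_class p a) = normal_form p a"
  unfolding coord_def skew_class_def skew_ideal_eq_kernel[OF antisym p_nonzero]
  using ring_hom_ring.the_elem_simp[OF normal_form_ring_hom_ring[of p], of a] by simp

lemma coord_inj: "u \<in> carrier S \<Longrightarrow> v \<in> carrier S \<Longrightarrow> coord u = coord v \<Longrightarrow> u = v"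
  using coord_ring_iso unfolding ring_iso_def bij_betw_def inj_on_def by blast

lemma coord_mult [simp]:
  "u \<in> carrier S \<Longrightarrow> v \<in> carrier S \<Longrightarrow> coord (u \<otimes>\<^bsub>S\<^esub> v) = twisted_mult p (coord u) (coord v)"
  using ring_iso_memE(2)[OF coord_ring_iso] by simp

lemma coord_add [simp]:
  "u \<in> carrier S \<Longrightarrow> v \<in> carrier S \<Longrightarrow> coord (u \<oplus>\<^bsub>S\<^esub> v) = coord u + coord v"
  using ring_iso_memE(3)[OF coord_ring_iso] by simp

lemma coord_one [simp]: "coord \<one>\<^bsub>S\<^esub> = Poly_Mapping.single (\<lambda>_. 0) 1"
  using ring_iso_memE(4)[OF coord_ring_iso] by simp

lemma from_coord_carrier [simp]: "from_coord m \<in> carrier S"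
  by (simp add: from_coord_def)

lemma coord_from_coord [simp]: "coord (from_coord m) = m"
  by (simp add: from_coord_def normal_form_lift_normal)

lemma from_coord_coord [simp]: "u \<in> carrier S \<Longrightarrow> from_coord (coord u) = u"
  by (rule coord_inj) simp_all

lemma mult_carrier [simp]: "u \<in> carrier S \<Longrightarrow> v \<in> carrier S \<Longrightarrow> u \<otimes>\<^bsub>S\<^esub> v \<in> carrier S"
  using ring_skew_poly_ring[of p] by (simp add: ring.ring_simprules)

lemma add_carrier [simp]: "u \<in> carrier S \<Longrightarrow> v \<in> carrier S \<Longrightarrow> u \<oplus>\<^bsub>S\<^esub> v \<in> carrier S"
  using ring_skew_poly_ring[of p] by (simp add: ring.ring_simprules)

lemma one_carrier [simp]: "\<one>\<^bsub>S\<^esub> \<in> carrier S"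
  using ring_skew_poly_ring[of p] by (simp add: ring.ring_simprules)

lemma skew_var_carrier [simp]: "skew_var p i \<in> carrier S"
  by (simp add: skew_var_def)

lemma coord_skew_var [simp]: "coord (skew_var p i) = Poly_Mapping.single (unit_exp i) 1"
  by (simp add: skew_var_def normal_form_gen)

lemma coord_skew_scalar: "coord (skew_scalar p c) = Poly_Mapping.single (\<lambda>_. 0) c"
  by (simp add: skew_scalar_def normal_form_scalar)

lemma skew_monomial_carrier [simp]: "skew_monomial p d \<in> carrier S"
  by (simp add: skew_monomial_def)

lemma coord_skew_monomial [simp]: "coord (skew_monomial p d) = Poly_Mapping.single d 1"
  by (simp add: skew_monomial_def prod_list_free_gen_power normal_form_single
      word_factor_sorted sorted_sorted_word flip: sorted_word_def)

lemma sort_factor_nonzero [simp]: "sort_factor p d e \<noteq> 0"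
  by (simp add: sort_factor_def)

lemma commutation_char_nonzero [simp]: "commutation_char p d e \<noteq> 0"
  by (simp add: commutation_char_def)

text \<open>Among the pairs \<open>(i, s)\<close> in \<open>commutation_char p d e\<close>, those
  with \<open>i < s\<close> give \<open>sort_factor p e d\<close>, those with \<open>s < i\<close>
  give the inverse of \<open>sort_factor p d e\<close>, and the diagonal is trivial.\<close>

lemma sort_factor_swap: "sort_factor p e d = commutation_char p d e * sort_factor p d e"
proof -
  have split: "(\<Prod>s\<in>UNIV. p i s ^ (d i * e s))
      = (\<Prod>s\<in>{i<..}. p i s ^ (d i * e s)) * (\<Prod>s\<in>{..<i}. p i s ^ (d i * e s))" for i
  proof -
    have "UNIV = insert i ({i<..} \<union> {..<i})" by auto
    then have "(\<Prod>s\<in>UNIV. p i s ^ (d i * e s))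
        = (\<Prod>s\<in>insert i ({i<..} \<union> {..<i}). p i s ^ (d i * e s))"
      by simp
    also have "\<dots> = (\<Prod>s\<in>{i<..} \<union> {..<i}. p i s ^ (d i * e s))"
      by simp
    also have "\<dots> = (\<Prod>s\<in>{i<..}. p i s ^ (d i * e s)) * (\<Prod>s\<in>{..<i}. p i s ^ (d i * e s))"
      by (rule prod.union_disjoint) auto
    finally show ?thesis .
  qed
  have "(\<Prod>i\<in>UNIV. \<Prod>s\<in>{i<..}. p i s ^ (d i * e s)) = sort_factor p e d"
  proof -
    have "(\<Prod>i\<in>UNIV. \<Prod>s\<in>{i<..}. p i s ^ (d i * e s))
        = (\<Prod>i\<in>UNIV. \<Prod>s\<in>{s \<in> UNIV. i < s}. p i s ^ (d i * e s))"
      by (simp add: greaterThan_def)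
    also have "\<dots> = (\<Prod>s\<in>UNIV. \<Prod>i\<in>{i \<in> UNIV. i < s}. p i s ^ (d i * e s))"
      by (rule prod.swap_restrict) auto
    finally show ?thesis
      by (simp add: sort_factor_def lessThan_def mult.commute)
  qed
  moreover have "(\<Prod>i\<in>UNIV. \<Prod>s\<in>{..<i}. p i s ^ (d i * e s)) * sort_factor p d e = 1"
    unfolding sort_factor_def prod.distrib[symmetric]
    by (intro prod.neutral ballI) (simp add: p_mult_swap flip: power_mult_distrib)
  ultimately show ?thesis
    by (simp add: commutation_char_def split prod.distrib mult.assoc)
qed

lemma commutation_char_add:
  "commutation_char p (\<lambda>i. d i + d' i) = (\<lambda>e. commutation_char p d e * commutation_char p d' e)"
  by (rule ext) (simp add: commutation_char_def ring_distribs power_add prod.distrib)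

lemma commutation_char_scale:
  "commutation_char p (\<lambda>i. N * d i) = (\<lambda>e. commutation_char p d e ^ N)"
proof
  fix e
  have "x ^ (N * a * b) = (x ^ (a * b)) ^ N" for x :: 'k and a b
    by (metis mult.assoc mult.commute power_mult)
  then show "commutation_char p (\<lambda>i. N * d i) e = commutation_char p d e ^ N"
    by (simp add: commutation_char_def prod_power_distrib)
qed

lemma commutation_char_zero [simp]: "commutation_char p (\<lambda>_. 0) = (\<lambda>_. 1)"
  by (rule ext) (simp add: commutation_char_def)

lemma commutation_char_unit_right:
  "commutation_char p d (unit_exp s) = (\<Prod>i\<in>UNIV. p i s ^ d i)"
proof -
  have "(\<Prod>r\<in>UNIV. p i r ^ (d i * unit_exp s r)) = p i s ^ d i" for i
  proof -
    have "(\<Prod>r\<in>UNIV. p i r ^ (d i * unit_exp s r)) = (\<Prod>r\<in>UNIV. if r = s then p i s ^ d i else 1)"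
      by (rule prod.cong) (auto simp: unit_exp_def)
    then show ?thesis by simp
  qed
  then show ?thesis by (simp add: commutation_char_def)
qed

text \<open>A character is determined by its values on the variables; this reduces every identity of
  characters to those values.\<close>

lemma commutation_char_eq_prod:
  "commutation_char p d e = (\<Prod>s\<in>UNIV. commutation_char p d (unit_exp s) ^ e s)"
proof -
  have "commutation_char p d e = (\<Prod>s\<in>UNIV. \<Prod>i\<in>UNIV. p i s ^ (d i * e s))"
    unfolding commutation_char_def by (rule prod.swap)
  then show ?thesis
    by (simp add: commutation_char_unit_right prod_power_distrib power_mult)
qed

lemma inj_add_exp: "inj (\<lambda>d (i::'n). d i + (e i::nat))"
  by (auto simp: inj_def fun_eq_iff)

text \<open>Multiplication by \<open>x^e\<close> translates exponents injectively, so no terms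
  merge. The left version reads off the same exponent, which makes the two products
  comparable.\<close>

lemma lookup_mult_single_right:
  "Poly_Mapping.lookup (twisted_mult p f (Poly_Mapping.single e 1)) (\<lambda>i. d i + e i)
    = sort_factor p d e * Poly_Mapping.lookup f d"
  using lookup_pm_extend_inj[OF inj_add_exp, of "\<lambda>d a. sort_factor p d e * a * 1" e f d]
  by (simp add: twisted_mult_def pm_extend_single)

lemma lookup_mult_single_left:
  "Poly_Mapping.lookup (twisted_mult p (Poly_Mapping.single e 1) f) (\<lambda>i. d i + e i)
    = sort_factor p e d * Poly_Mapping.lookup f d"
  using lookup_pm_extend_inj[OF inj_add_exp, of "\<lambda>d a. sort_factor p e d * 1 * a" e f d]
  by (simp add: twisted_mult_def pm_extend_def add.commute)

subsection \<open>The center and the conjugations in coordinates\<close>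

text \<open>Forward, commutation with each variable is compared coefficientwise; backward, each term
  of \<open>u\<close> already commutes with every monomial.\<close>

lemma mem_center_iff:
  "u \<in> ring_center S \<longleftrightarrow>
    u \<in> carrier S \<and> (\<forall>d\<in>Poly_Mapping.keys (coord u). commutation_char p d = (\<lambda>_. 1))"
proof (intro iffI conjI ballI)
  assume u: "u \<in> ring_center S"
  then show carrier: "u \<in> carrier S" by (simp add: ring_center_def)
  fix d assume d: "d \<in> Poly_Mapping.keys (coord u)"
  have "commutation_char p d (unit_exp i) = 1" for i
  proof -
    have "u \<otimes>\<^bsub>S\<^esub> skew_var p i = skew_var p i \<otimes>\<^bsub>S\<^esub> u"
      using u by (simp add: ring_center_def)
    from arg_cong[where f = coord, OF this]
    have "twisted_mult p (coord u) (Poly_Mapping.single (unit_exp i) 1)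
        = twisted_mult p (Poly_Mapping.single (unit_exp i) 1) (coord u)"
      using carrier by simp
    \<comment> \<open>On either side, only the term of \<open>u\<close> at \<open>d\<close>
      contributes to this exponent.\<close>
    from arg_cong[where f = "\<lambda>f. Poly_Mapping.lookup f (\<lambda>k. d k + unit_exp i k)", OF this]
    have "sort_factor p d (unit_exp i) * Poly_Mapping.lookup (coord u) d
        = sort_factor p (unit_exp i) d * Poly_Mapping.lookup (coord u) d"
      by (simp only: lookup_mult_single_left lookup_mult_single_right)
    then have "sort_factor p d (unit_exp i) = sort_factor p (unit_exp i) d"
      using d by (simp add: in_keys_iff)
    then show ?thesis
      by (simp add: sort_factor_swap[of "unit_exp i" d])
  qed
  then show "commutation_char p d = (\<lambda>_. 1)"
    by (subst commutation_char_eq_prod[abs_def]) simp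
next
  assume u: "u \<in> carrier S \<and> (\<forall>d\<in>Poly_Mapping.keys (coord u). commutation_char p d = (\<lambda>_. 1))"
  have "u \<otimes>\<^bsub>S\<^esub> v = v \<otimes>\<^bsub>S\<^esub> u" if "v \<in> carrier S" for v
  proof (rule coord_inj)
    have "twisted_mult p (coord u) (coord v) = twisted_mult p (coord v) (coord u)"
    proof (rule biadditive_eqI[where F = "twisted_mult p" and G = "\<lambda>f g. twisted_mult p g f"])
      fix d a e c assume "d \<in> Poly_Mapping.keys (coord u)"
      then have "sort_factor p e d = sort_factor p d e"
        using u by (simp add: sort_factor_swap[of e d])
      then show "twisted_mult p (Poly_Mapping.single d a) (Poly_Mapping.single e c)
          = twisted_mult p (Poly_Mapping.single e c) (Poly_Mapping.single d a)"
        by (simp add: twisted_mult_single mult_ac add.commute)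
    qed (simp_all add: additive_twisted_mult_left additive_twisted_mult_right)
    then show "coord (u \<otimes>\<^bsub>S\<^esub> v) = coord (v \<otimes>\<^bsub>S\<^esub> u)"
      using u that by simp
  qed (use u that in simp_all)
  then show "u \<in> ring_center S"
    using u by (simp add: ring_center_def)
qed

lemma skew_monomial_mem_center:
  "skew_monomial p d \<in> ring_center S \<longleftrightarrow> commutation_char p d = (\<lambda>_. 1)"
  by (simp add: mem_center_iff)

section \<open>Diagonal maps and the group generated by the conjugations\<close>

definition scale :: "(('n \<Rightarrow> nat) \<Rightarrow> 'k) \<Rightarrow> (('n \<Rightarrow> nat) \<Rightarrow>\<^sub>0 'k) \<Rightarrow> (('n \<Rightarrow> nat) \<Rightarrow>\<^sub>0 'k)"
  where "scale \<chi> = pm_extend (\<lambda>d a. Poly_Mapping.single d (\<chi> d * a))"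

lemma lookup_scale [simp]: "Poly_Mapping.lookup (scale \<chi> f) d = \<chi> d * Poly_Mapping.lookup f d"
  unfolding scale_def using lookup_pm_extend_inj[of "\<lambda>d. d" "\<lambda>d a. \<chi> d * a"] by simp

lemma scale_scale: "scale \<chi> (scale \<psi> f) = scale (\<lambda>d. \<chi> d * \<psi> d) f"
  by (rule poly_mapping_eqI) simp

lemma scale_one [simp]: "scale (\<lambda>_. 1) f = f"
  by (rule poly_mapping_eqI) simp

text \<open>For nonvanishing \<open>\<chi>\<close> only bijectivity is established, which suffices
  because \<open>conj_group\<close> is generated inside \<open>BijGroup\<close>; the restriction
  gives the extensionality that membership there demands.\<close>

definition scale_aut ::
    "(('n \<Rightarrow> nat) \<Rightarrow> 'k) \<Rightarrow> ('n, 'k) free_alg set \<Rightarrow> ('n, 'k) free_alg set"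
  where "scale_aut \<chi> = (\<lambda>u\<in>carrier S. from_coord (scale \<chi> (coord u)))"

text \<open>Conjugation by \<open>x^e\<close> in a form free of inverses; on monomials it is
  \<open>sort_factor_swap\<close>.\<close>

lemma twisted_mult_scale:
  "twisted_mult p (Poly_Mapping.single e 1) (scale (commutation_char p e) f)
    = twisted_mult p f (Poly_Mapping.single e 1)"
proof (rule additive_eqI[where G = "\<lambda>f. twisted_mult p f (Poly_Mapping.single e 1)"
      and F = "\<lambda>f. twisted_mult p (Poly_Mapping.single e 1) (scale (commutation_char p e) f)"])
  have add: "Modules.additive (scale \<chi>)" for \<chi>
    unfolding scale_def by (rule additive_pm_extend) (rule additive_single_scale)
  show "Modules.additive (\<lambda>f. twisted_mult p (Poly_Mapping.single e 1) (scale (commutation_char p e) f))"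
    by (simp add: additive.intro additive.add[OF additive_twisted_mult_right] additive.add[OF add])
  show "Modules.additive (\<lambda>f. twisted_mult p f (Poly_Mapping.single e 1))"
    by (rule additive_twisted_mult_left)
  fix d a
  show "twisted_mult p (Poly_Mapping.single e 1) (scale (commutation_char p e) (Poly_Mapping.single d a))
      = twisted_mult p (Poly_Mapping.single d a) (Poly_Mapping.single e 1)"
    by (simp add: scale_def pm_extend_single twisted_mult_single sort_factor_swap[of d e] mult_ac add.commute)
qed

text \<open>Each coefficient of \<open>x^e f\<close> is a nonzero multiple of one of
  \<open>f\<close>. This supplies the uniqueness required by the description in
  \<open>conj_aut\<close>.\<close>

lemma twisted_mult_single_inj:
  assumes "twisted_mult p (Poly_Mapping.single e 1) f = twisted_mult p (Poly_Mapping.single e 1) g"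
  shows "f = g"
proof (rule poly_mapping_eqI)
  fix d
  from arg_cong[where f = "\<lambda>f. Poly_Mapping.lookup f (\<lambda>i. d i + e i)", OF assms]
  have "sort_factor p e d * Poly_Mapping.lookup f d = sort_factor p e d * Poly_Mapping.lookup g d"
    by (simp only: lookup_mult_single_left)
  then show "Poly_Mapping.lookup f d = Poly_Mapping.lookup g d"
    by simp
qed

lemma conj_aut_eq: "conj_aut p i = scale_aut (commutation_char p (unit_exp i))"
  unfolding conj_aut_def scale_aut_def
proof (rule restrict_ext, rule the_equality)
  fix u assume u: "u \<in> carrier S"
  let ?g = "from_coord (scale (commutation_char p (unit_exp i)) (coord u))"
  have eq: "skew_var p i \<otimes>\<^bsub>S\<^esub> ?g = u \<otimes>\<^bsub>S\<^esub> skew_var p i"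
    by (rule coord_inj) (simp_all add: u twisted_mult_scale)
  then show "?g \<in> carrier S \<and> skew_var p i \<otimes>\<^bsub>S\<^esub> ?g = u \<otimes>\<^bsub>S\<^esub> skew_var p i"
    by simp
  fix h assume h: "h \<in> carrier S \<and> skew_var p i \<otimes>\<^bsub>S\<^esub> h = u \<otimes>\<^bsub>S\<^esub> skew_var p i"
  then have "coord (skew_var p i \<otimes>\<^bsub>S\<^esub> h) = coord (skew_var p i \<otimes>\<^bsub>S\<^esub> ?g)"
    using eq by simp
  then have "twisted_mult p (Poly_Mapping.single (unit_exp i) 1) (coord h)
      = twisted_mult p (Poly_Mapping.single (unit_exp i) 1) (coord ?g)"
    using coord_mult[of "skew_var p i" h] coord_mult[of "skew_var p i" ?g] conjunct1[OF h]
    by (simp only: coord_skew_var skew_var_carrier from_coord_carrier)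
  then have "coord h = coord ?g"
    by (rule twisted_mult_single_inj)
  then show "h = ?g"
    using h by (intro coord_inj) simp_all
qed

lemma scale_aut_Bij:
  assumes "\<And>d. \<chi> d \<noteq> 0"
  shows "scale_aut \<chi> \<in> Bij (carrier S)"
proof -
  have "bij_betw (scale_aut \<chi>) (carrier S) (carrier S)"
    by (rule bij_betw_byWitness[where f' = "scale_aut (\<lambda>d. inverse (\<chi> d))"])
      (auto simp: scale_aut_def scale_scale assms)
  then show ?thesis
    by (simp add: Bij_def scale_aut_def)
qed

lemma scale_aut_compose:
  "compose (carrier S) (scale_aut \<chi>) (scale_aut \<psi>) = scale_aut (\<lambda>d. \<chi> d * \<psi> d)"
  by (rule ext) (auto simp: compose_def scale_aut_def scale_scale)

lemma scale_aut_one: "scale_aut (\<lambda>_. 1) = (\<lambda>u\<in>carrier S. u)"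
  by (rule ext) (simp add: scale_aut_def restrict_def)

lemma scale_aut_inj: "scale_aut \<chi> = scale_aut \<psi> \<Longrightarrow> \<chi> = \<psi>"
proof
  fix d assume "scale_aut \<chi> = scale_aut \<psi>"
  then have "coord (scale_aut \<chi> (skew_monomial p d)) = coord (scale_aut \<psi> (skew_monomial p d))"
    by simp
  then have "scale \<chi> (Poly_Mapping.single d 1) = scale \<psi> (Poly_Mapping.single d 1)"
    by (simp add: scale_aut_def)
  from arg_cong[where f = "\<lambda>f. Poly_Mapping.lookup f d", OF this] show "\<chi> d = \<psi> d"
    by simp
qed

abbreviation "G \<equiv> BijGroup (carrier S)"

lemma commutation_aut_mult:
  "scale_aut (commutation_char p d) \<otimes>\<^bsub>G\<^esub> scale_aut (commutation_char p e)
    = scale_aut (commutation_char p (\<lambda>i. d i + e i))"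
  by (simp add: BijGroup_def scale_aut_Bij scale_aut_compose commutation_char_add)

lemma commutation_aut_one: "scale_aut (commutation_char p (\<lambda>_. 0)) = \<one>\<^bsub>G\<^esub>"
  by (simp add: BijGroup_def scale_aut_one)

text \<open>There are finitely many \<open>p i j\<close>, so one exponent kills them all. It lets
  inverses in the group be written as nonnegative powers.\<close>

lemma ex_common_order: "\<exists>N>0. \<forall>d e. commutation_char p d e ^ N = 1"
proof -
  define m where "m = (\<lambda>i j. SOME r. 0 < r \<and> p i j ^ r = 1)"
  have m: "0 < m i j \<and> p i j ^ m i j = 1" for i j
    unfolding m_def using root_of_unity[of i j] unfolding root_of_unity_def by (rule someI_ex)
  define N where "N = (\<Prod>i\<in>UNIV. \<Prod>j\<in>UNIV. m i j)"
  have "m i j dvd N" for i j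
    unfolding N_def by (meson UNIV_I dvd_prodI dvd_trans finite)
  then have pN: "p i j ^ N = 1" for i j
    using m by (metis dvdE power_mult power_one)
  have "commutation_char p d e ^ N = 1" for d e
  proof -
    have "(p i j ^ a) ^ N = 1" for i j a
      by (metis pN power_mult mult.commute power_one)
    then show ?thesis
      by (simp add: commutation_char_def prod_power_distrib)
  qed
  moreover have "N > 0"
    using m by (simp add: N_def prod_pos)
  ultimately show ?thesis by blast
qed

text \<open>With natural exponents the right side is at first only a monoid; finite order closes it
  under inverses. Conversely, each of its maps is built from the generators by induction on the
  total degree.\<close>

lemma conj_group_eq: "conj_group p = (\<lambda>d. scale_aut (commutation_char p d)) ` UNIV"
proof (intro equalityI subsetI)
  interpret G: group G by (rule group_BijGroup)
  fix x assume "x \<in> conj_group p"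
  then have "x \<in> generate G (range (conj_aut p))"
    by (simp add: conj_group_def)
  then show "x \<in> (\<lambda>d. scale_aut (commutation_char p d)) ` UNIV"
  proof (induction rule: generate.induct)
    case one
    then show ?case
      by (metis commutation_aut_one rangeI)
  next
    case (incl h)
    then show ?case
      by (auto simp: conj_aut_eq)
  next
    case (inv h)
    then obtain i where h: "h = scale_aut (commutation_char p (unit_exp i))"
      by (auto simp: conj_aut_eq)
    obtain N where N: "N > 0" "\<And>d e. commutation_char p d e ^ N = 1"
      using ex_common_order by blast
    \<comment> \<open>The inverse of \<open>h\<close> is its power \<open>N - 1\<close>;
      \<open>N > 0\<close> makes the natural subtraction exact.\<close>
    let ?h' = "scale_aut (commutation_char p (\<lambda>k. (N - 1) * unit_exp i k))"
    have "(\<lambda>k. (N - 1) * unit_exp i k + unit_exp i k) = (\<lambda>k. N * unit_exp i k)"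
      using N(1) by (cases N) auto
    then have "?h' \<otimes>\<^bsub>G\<^esub> h = scale_aut (commutation_char p (\<lambda>k. N * unit_exp i k))"
      unfolding h by (simp only: commutation_aut_mult)
    also have "\<dots> = \<one>\<^bsub>G\<^esub>"
      by (simp add: commutation_char_scale N(2) BijGroup_def scale_aut_one)
    finally have "?h' \<otimes>\<^bsub>G\<^esub> h = \<one>\<^bsub>G\<^esub>" .
    moreover have "h \<in> carrier G" "?h' \<in> carrier G"
      unfolding h by (simp_all add: BijGroup_def scale_aut_Bij)
    ultimately have "inv\<^bsub>G\<^esub> h = ?h'"
      by (rule G.inv_equality)
    then show ?case by blast
  next
    case (eng h1 h2)
    then show ?case
      by (auto simp: commutation_aut_mult)
  qed
next
  fix x assume "x \<in> (\<lambda>d. scale_aut (commutation_char p d)) ` UNIV"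
  then obtain d where x: "x = scale_aut (commutation_char p d)" by blast
  have "scale_aut (commutation_char p d) \<in> generate G (range (conj_aut p))"
  proof (induction "\<Sum>i\<in>UNIV. d i" arbitrary: d)
    case 0
    then have "d = (\<lambda>_. 0)" by auto
    then show ?case
      by (simp add: commutation_aut_one generate.one del: commutation_char_zero)
  next
    case (Suc m)
    then have "(\<Sum>i\<in>UNIV. d i) \<noteq> 0" by linarith
    then obtain i where i: "d i > 0"
      by (metis (no_types) gr0I sum.neutral)
    \<comment> \<open>One variable is split off, lowering the total degree by one.\<close>
    define d' where "d' = d(i := d i - 1)"
    have d: "d = (\<lambda>k. d' k + unit_exp i k)"
      using i by (auto simp: d'_def unit_exp_def)
    have "(\<Sum>k\<in>UNIV. d k) = (\<Sum>k\<in>UNIV. d' k) + 1"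
      by (subst d) (simp add: sum.distrib unit_exp_def)
    then have "scale_aut (commutation_char p d') \<in> generate G (range (conj_aut p))"
      using Suc by (intro Suc.hyps(1)) simp
    then have "scale_aut (commutation_char p d') \<otimes>\<^bsub>G\<^esub> conj_aut p i \<in> generate G (range (conj_aut p))"
      by (rule generate.eng) (auto intro: generate.incl)
    then show ?case
      by (subst d) (simp add: conj_aut_eq commutation_aut_mult)
  qed
  with x show "x \<in> conj_group p"
    by (simp add: conj_group_def)
qed

end

subsection \<open>Orders of roots of unity\<close>

lemma coprime_cong_prod:
  fixes x y :: nat
  assumes "\<And>i. i \<in> A \<Longrightarrow> [x = y] (mod m i)"
    and "\<And>i j. i \<in> A \<Longrightarrow> j \<in> A \<Longrightarrow> i \<noteq> j \<Longrightarrow> coprime (m i) (m j)"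
  shows "[x = y] (mod (\<Prod>i\<in>A. m i))"
  using assms
  by (induction A rule: infinite_finite_induct)
    (auto intro!: coprime_cong_mult_nat prod_coprime_right)

lemma root_order:
  assumes "root_of_unity q"
  shows "0 < root_order q" "q ^ root_order q = 1"
proof -
  have "0 < root_order q \<and> q ^ root_order q = 1"
    unfolding root_order_def by (rule LeastI_ex) (use assms in \<open>simp add: root_of_unity_def\<close>)
  then show "0 < root_order q" "q ^ root_order q = 1" by auto
qed

lemma root_of_unity_nonzero: "root_of_unity q \<Longrightarrow> q \<noteq> 0"
  by (auto simp: root_of_unity_def power_0_left)

lemma power_eq_one_iff_root_order:
  assumes "root_of_unity q"
  shows "q ^ d = 1 \<longleftrightarrow> root_order q dvd d"
proof
  assume "q ^ d = 1"
  moreover have "q ^ d = (q ^ root_order q) ^ (d div root_order q) * q ^ (d mod root_order q)"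
    by (simp flip: power_mult power_add)
  ultimately have "q ^ (d mod root_order q) = 1"
    by (simp add: root_order(2)[OF assms])
  moreover have "d mod root_order q < root_order q"
    using root_order(1)[OF assms] by simp
  ultimately have "d mod root_order q = 0"
    using not_less_Least[of "d mod root_order q" "\<lambda>d. 0 < d \<and> q ^ d = 1"]
    unfolding root_order_def[symmetric] by auto
  then show "root_order q dvd d" by auto
next
  assume "root_order q dvd d"
  then show "q ^ d = 1"
    by (auto elim!: dvdE simp: power_mult root_order(2)[OF assms])
qed

lemma power_eq_iff_cong_root_order:
  assumes "root_of_unity q"
  shows "q ^ a = q ^ b \<longleftrightarrow> [a = b] (mod root_order q)"
proof (induction a b rule: linorder_wlog)
  case (le a b)
  have "q ^ b = q ^ a * q ^ (b - a)"
    using le by (simp flip: power_add)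
  then have "q ^ a = q ^ b \<longleftrightarrow> q ^ (b - a) = 1"
    using root_of_unity_nonzero[OF assms] by auto
  also have "\<dots> \<longleftrightarrow> [a = b] (mod root_order q)"
    using le by (simp add: power_eq_one_iff_root_order[OF assms] cong_altdef_nat cong_sym_eq[of a])
  finally show ?case .
next
  case (sym a b)
  then show ?case by (metis cong_sym_eq)
qed

lemma powi_eq_one_iff_root_order:
  assumes "root_of_unity q"
  shows "q powi z = 1 \<longleftrightarrow> int (root_order q) dvd z"
proof (cases "z \<ge> 0")
  case True
  then obtain n where "z = int n"
    by (metis nonneg_int_cases)
  then show ?thesis
    by (simp add: power_eq_one_iff_root_order[OF assms])
next
  case False
  then obtain n where "z = - int n"
    by (metis nonpos_int_cases linear)
  then show ?thesis
    by (simp add: power_int_minus power_eq_one_iff_root_order[OF assms])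
qed

lemma root_order_eqI:
  assumes "0 < m" "\<And>d. q ^ d = 1 \<longleftrightarrow> m dvd d"
  shows "root_of_unity q" "root_order q = m"
proof -
  show "root_of_unity q"
    using assms by (auto simp: root_of_unity_def)
  show "root_order q = m"
    unfolding root_order_def using assms by (intro Least_equality) (auto dest: dvd_imp_le)
qed

lemma root_order_one [simp]: "root_order 1 = 1"
  by (rule root_order_eqI) auto

lemma root_order_inverse: "root_order (inverse q) = root_order q"
  by (simp add: root_order_def power_inverse)

subsection \<open>Pairwise coprime orders\<close>

locale coprime_skew_setting = skew_setting p for p :: "'n::{finite,linorder} \<Rightarrow> 'n \<Rightarrow> 'k::field" +
  assumes coprime_orders: "orders_pairwise_coprime p"
begin

abbreviation "ord i j \<equiv> root_order (p i j)"

lemma ord_pos [simp]: "0 < ord i j"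
  by (rule root_order(1)[OF root_of_unity])

lemma ord_commute: "ord j i = ord i j"
  by (simp add: p_swap[of j i] root_order_inverse)

text \<open>The hypothesis concerns pairs \<open>i < j\<close>; it extends to unordered pairs
  because orders are symmetric and a diagonal order is 1, which is coprime to everything.\<close>

lemma ord_coprime:
  assumes "{i, j} \<noteq> {s, t}"
  shows "coprime (ord i j) (ord s t)"
proof -
  have lt: "coprime (ord i j) (ord s t)" if "i < j" "s < t" "{i, j} \<noteq> {s, t}" for i j s t
    using coprime_orders that unfolding orders_pairwise_coprime_def by blast
  have le: "coprime (ord i j) (ord s t)" if "i \<le> j" "s \<le> t" "{i, j} \<noteq> {s, t}" for i j s t
    using that lt[of i j s t] by (cases "i = j"; cases "s = t") auto
  show ?thesis
    using assms le[of i j s t] le[of j i s t] le[of i j t s] le[of j i t s]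
    by (metis insert_commute linear ord_commute)
qed

text \<open>The exponent of the future generator \<open>x_i^(row_order i)\<close> of the center; the
  factor at \<open>j = i\<close> is 1.\<close>

definition row_order :: "'n \<Rightarrow> nat"
  where "row_order i = (\<Prod>j\<in>UNIV. ord i j)"

lemma row_order_pos [simp]: "0 < row_order i"
  by (simp add: row_order_def prod_pos)

text \<open>For fixed \<open>s\<close> the cyclic groups generated by the \<open>p i s\<close> have
  pairwise coprime orders, so their product is direct.\<close>

lemma column_prod_eq_iff:
  "(\<Prod>i\<in>UNIV. p i s ^ d i) = (\<Prod>i\<in>UNIV. p i s ^ e i) \<longleftrightarrow> (\<forall>i. p i s ^ d i = p i s ^ e i)"
proof (intro iffI allI)
  fix i
  assume eq: "(\<Prod>i\<in>UNIV. p i s ^ d i) = (\<Prod>i\<in>UNIV. p i s ^ e i)"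
  \<comment> \<open>The \<open>N\<close>-th power kills every factor but the \<open>i\<close>-th one, and \<open>N\<close> is prime to its order.\<close>
  define N where "N = (\<Prod>k\<in>UNIV - {i}. ord k s)"
  have pow: "(\<Prod>i\<in>UNIV. p i s ^ d i) ^ N = p i s ^ (d i * N)" for d :: "'n \<Rightarrow> nat"
  proof -
    have "(\<Prod>i\<in>UNIV. p i s ^ d i) ^ N = (\<Prod>k\<in>UNIV. p k s ^ (d k * N))"
      by (simp add: prod_power_distrib power_mult)
    also have "\<dots> = p i s ^ (d i * N) * (\<Prod>k\<in>UNIV - {i}. p k s ^ (d k * N))"
      by (rule prod.remove) auto
    also have "(\<Prod>k\<in>UNIV - {i}. p k s ^ (d k * N)) = 1"
    proof (rule prod.neutral, rule ballI)
      fix k assume "k \<in> UNIV - {i}"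
      then have "ord k s dvd N"
        unfolding N_def by (intro dvd_prodI) auto
      then show "p k s ^ (d k * N) = 1"
        by (simp add: power_eq_one_iff_root_order root_of_unity)
    qed
    finally show ?thesis by simp
  qed
  have "p i s ^ (d i * N) = p i s ^ (e i * N)"
    using eq pow by metis
  then have "[d i * N = e i * N] (mod ord i s)"
    by (simp add: power_eq_iff_cong_root_order root_of_unity)
  moreover have "coprime N (ord i s)"
    unfolding N_def by (intro prod_coprime_left ord_coprime) (auto simp: doubleton_eq_iff)
  ultimately show "p i s ^ d i = p i s ^ e i"
    by (simp add: cong_mult_rcancel_nat power_eq_iff_cong_root_order root_of_unity)
qed simp

text \<open>Equality is tested on variables, then factor by factor in each column; the congruences
  of row \<open>i\<close> are merged by the Chinese remainder theorem. Comparing two vectors avoids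
  subtracting natural exponents.\<close>

lemma commutation_char_eq_iff:
  "commutation_char p d = commutation_char p e \<longleftrightarrow> (\<forall>i. [d i = e i] (mod row_order i))"
proof -
  have "commutation_char p d = commutation_char p e
      \<longleftrightarrow> (\<forall>s. commutation_char p d (unit_exp s) = commutation_char p e (unit_exp s))"
  proof (intro iffI ext)
    fix x assume "\<forall>s. commutation_char p d (unit_exp s) = commutation_char p e (unit_exp s)"
    then show "commutation_char p d x = commutation_char p e x"
      unfolding commutation_char_eq_prod[of d x] commutation_char_eq_prod[of e x] by simp
  qed simp
  also have "\<dots> \<longleftrightarrow> (\<forall>i s. [d i = e i] (mod ord i s))"
    by (auto simp: commutation_char_unit_right column_prod_eq_iff power_eq_iff_cong_root_order
        root_of_unity)
  also have "\<dots> \<longleftrightarrow> (\<forall>i. [d i = e i] (mod row_order i))"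
  proof (intro iffI allI)
    fix i assume "\<forall>i s. [d i = e i] (mod ord i s)"
    then show "[d i = e i] (mod row_order i)"
      unfolding row_order_def by (intro coprime_cong_prod ord_coprime) (auto simp: doubleton_eq_iff)
  next
    fix i s assume "\<forall>i. [d i = e i] (mod row_order i)"
    moreover have "ord i s dvd row_order i"
      unfolding row_order_def by (intro dvd_prodI) auto
    ultimately show "[d i = e i] (mod ord i s)"
      by (blast intro: cong_dvd_modulus_nat)
  qed
  finally show ?thesis .
qed

lemma commutation_char_eq_one_iff:
  "commutation_char p d = (\<lambda>_. 1) \<longleftrightarrow> (\<forall>i. row_order i dvd d i)"
  using commutation_char_eq_iff[of d "\<lambda>_. 0"] by (simp add: cong_0_iff)

lemma center_gcd_eq: "center_gcd p i = row_order i"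
proof -
  have "center_gcd p i = Gcd {d i | d. \<forall>k. row_order k dvd d k}"
    by (simp add: center_gcd_def skew_monomial_mem_center commutation_char_eq_one_iff)
  also have "\<dots> = row_order i"
  proof (rule dvd_antisym)
    \<comment> \<open>The vector \<open>row_order\<close> itself belongs to a central monomial, so
      \<open>row_order i\<close> is among the numbers.\<close>
    show "Gcd {d i | d. \<forall>k. row_order k dvd d k} dvd row_order i"
      by (rule Gcd_dvd) (auto intro!: exI[of _ row_order])
    show "row_order i dvd Gcd {d i | d. \<forall>k. row_order k dvd d k}"
      by (rule Gcd_greatest) auto
  qed
  finally show ?thesis .
qed

lemma card_conj_group: "card (conj_group p) = (\<Prod>i\<in>UNIV. row_order i)"
proof -
  let ?F = "\<lambda>d. scale_aut (commutation_char p d)"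
  \<comment> \<open>The box of least residues: one representative for each class of exponents with
    the same character.\<close>
  let ?E = "PiE UNIV (\<lambda>i. {..<row_order i})"
  have eq: "?F d = ?F e \<longleftrightarrow> (\<forall>i. [d i = e i] (mod row_order i))" for d e
    using scale_aut_inj commutation_char_eq_iff by metis
  have "inj_on ?F ?E"
  proof (rule inj_onI)
    fix d e assume "d \<in> ?E" "e \<in> ?E" "?F d = ?F e"
    then have "d i = e i" for i
      by (intro cong_less_imp_eq_nat[of _ "row_order i"]) (auto simp: eq PiE_iff)
    then show "d = e" by auto
  qed
  moreover have "?F ` ?E = conj_group p"
  proof -
    have "?F d \<in> ?F ` ?E" for d
    proof (rule image_eqI)
      show "?F d = ?F (\<lambda>i. d i mod row_order i)"
        unfolding eq by (simp add: cong_def)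
      show "(\<lambda>i. d i mod row_order i) \<in> ?E"
        by auto
    qed
    then show ?thesis
      unfolding conj_group_eq by blast
  qed
  ultimately have "card (conj_group p) = card ?E"
    by (metis card_image)
  then show ?thesis
    by (simp add: card_PiE)
qed

section \<open>The product of all orders and its identification with \<open>l\<close>\<close>

definition total_order :: nat
  where "total_order = (\<Prod>i\<in>UNIV. \<Prod>j\<in>{i<..}. ord i j)"

lemma total_order_pos: "0 < total_order"
  by (simp add: total_order_def prod_pos)

text \<open>Each pair of distinct indices occurs in two rows, and the diagonal contributes
  1.\<close>

lemma prod_row_order: "(\<Prod>i\<in>UNIV. row_order i) = total_order ^ 2"
proof -
  have "row_order i = (\<Prod>j\<in>{i<..}. ord i j) * (\<Prod>j\<in>{..<i}. ord i j)" for i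
  proof -
    have "UNIV = insert i ({i<..} \<union> {..<i})" by auto
    then have "row_order i = (\<Prod>j\<in>insert i ({i<..} \<union> {..<i}). ord i j)"
      by (simp add: row_order_def)
    also have "\<dots> = (\<Prod>j\<in>{i<..} \<union> {..<i}. ord i j)"
      by simp
    also have "\<dots> = (\<Prod>j\<in>{i<..}. ord i j) * (\<Prod>j\<in>{..<i}. ord i j)"
      by (rule prod.union_disjoint) auto
    finally show ?thesis .
  qed
  moreover have "(\<Prod>i\<in>UNIV. \<Prod>j\<in>{..<i}. ord i j) = total_order"
  proof -
    have "(\<Prod>i\<in>UNIV. \<Prod>j\<in>{..<i}. ord i j) = (\<Prod>i\<in>UNIV. \<Prod>j\<in>{j \<in> UNIV. j < i}. ord i j)"
      by (simp add: lessThan_def)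
    also have "\<dots> = (\<Prod>j\<in>UNIV. \<Prod>i\<in>{i \<in> UNIV. j < i}. ord i j)"
      by (rule prod.swap_restrict) auto
    also have "\<dots> = (\<Prod>j\<in>UNIV. \<Prod>i\<in>{i \<in> UNIV. j < i}. ord j i)"
      by (intro prod.cong refl ord_commute)
    finally show ?thesis
      by (simp add: total_order_def greaterThan_def)
  qed
  ultimately show ?thesis
    by (simp add: prod.distrib total_order_def power2_eq_square)
qed

lemma ord_dvd_total_order: "ord i j dvd total_order"
proof -
  have lt: "ord i j dvd total_order" if "i < j" for i j
  proof -
    have "ord i j dvd (\<Prod>j\<in>{i<..}. ord i j)"
      using that by (intro dvd_prodI) auto
    also have "\<dots> dvd total_order"
      unfolding total_order_def by (rule dvd_prodI) auto
    finally show ?thesis .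
  qed
  show ?thesis
    using lt[of i j] lt[of j i] ord_commute[of i j] by (cases i j rule: linorder_cases) auto
qed

lemma total_order_dvd:
  assumes "\<And>i j. ord i j dvd l"
  shows "total_order dvd l"
proof -
  have "total_order = (\<Prod>(i, j)\<in>(SIGMA i:UNIV. {i<..}). ord i j)"
    unfolding total_order_def by (rule prod.Sigma) auto
  \<comment> \<open>Divisibility is read as congruence to 0, so that the factors combine by
    coprimality.\<close>
  moreover have "[l = 0] (mod (\<Prod>(i, j)\<in>(SIGMA i:UNIV. {i<..}). ord i j))"
  proof (rule coprime_cong_prod)
    fix x y :: "'n \<times> 'n"
    assume "x \<in> (SIGMA i:UNIV. {i<..})" "y \<in> (SIGMA i:UNIV. {i<..})" "x \<noteq> y"
    then show "coprime (case x of (i, j) \<Rightarrow> ord i j) (case y of (i, j) \<Rightarrow> ord i j)"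
      by (auto intro!: ord_coprime simp: doubleton_eq_iff)
  qed (use assms in \<open>auto simp: cong_0_iff\<close>)
  ultimately show ?thesis
    by (simp add: cong_0_iff)
qed

text \<open>All orders divide \<open>l\<close>, hence so does their product. Were the quotient
  \<open>t\<close> larger than 1, replacing \<open>\<xi>\<close> by \<open>\<xi> ^ t\<close> and
  dividing all \<open>b i j\<close> by \<open>t\<close> would contradict minimality.\<close>

lemma total_order_eq:
  assumes "minimal_exponent_data p l \<xi> b"
  shows "total_order = l"
proof -
  have xi: "root_of_unity \<xi>" "root_order \<xi> = l" and p: "\<And>i j. p i j = \<xi> powi b i j"
    and b: "\<And>i. b i i = 0" "\<And>i j. b j i = - b i j"
    and min: "\<And>l' \<xi>' b'. exponent_data p l' \<xi>' b' \<Longrightarrow> l \<le> l'"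
    using assms
    unfolding minimal_exponent_data_def exponent_data_def primitive_root_of_unity_def by blast+
  have l: "0 < l" "\<xi> ^ l = 1"
    using root_order[OF xi(1)] xi(2) by auto
  have "p i j ^ l = 1" for i j
  proof -
    have "p i j ^ l = \<xi> powi (b i j * int l)"
      by (simp add: p power_int_mult)
    then show ?thesis
      by (simp add: powi_eq_one_iff_root_order xi)
  qed
  then have dvd: "total_order dvd l"
    by (intro total_order_dvd) (simp add: power_eq_one_iff_root_order root_of_unity)
  then obtain t where t: "l = total_order * t" by blast
  with l have "0 < t" by (cases t) auto
  \<comment> \<open>Since \<open>l = total_order * t\<close>, the power \<open>\<xi> ^ t\<close> has
    order exactly \<open>total_order\<close>.\<close>
  have prim: "(\<xi> ^ t) ^ d = 1 \<longleftrightarrow> total_order dvd d" for d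
    using \<open>0 < t\<close> xi(2) t
    by (simp add: power_eq_one_iff_root_order[OF xi(1)] mult.commute[of t] flip: power_mult)
  \<comment> \<open>From \<open>p i j ^ total_order = 1\<close> it follows that \<open>l\<close>
    divides \<open>b i j * total_order\<close>; cancelling \<open>total_order\<close> leaves
    \<open>t\<close>.\<close>
  have t_dvd: "int t dvd b i j" for i j
  proof -
    have "\<xi> powi (b i j * int total_order) = p i j ^ total_order"
      by (simp add: p power_int_mult)
    also have "\<dots> = 1"
      by (simp add: power_eq_one_iff_root_order root_of_unity ord_dvd_total_order)
    finally have "int l dvd b i j * int total_order"
      by (simp add: powi_eq_one_iff_root_order xi)
    then show ?thesis
      using total_order_pos by (simp add: t mult.commute[of "int total_order"])
  qed
  have "exponent_data p total_order (\<xi> ^ t) (\<lambda>i j. b i j div int t)"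
    unfolding exponent_data_def primitive_root_of_unity_def
  proof (intro conjI allI)
    show "root_of_unity (\<xi> ^ t)" "root_order (\<xi> ^ t) = total_order"
      using root_order_eqI[OF total_order_pos prim] by auto
    show "b i i div int t = 0" for i
      by (simp add: b)
    show "b j i div int t = - (b i j div int t)" for i j
      using t_dvd[of i j] b(2)[of j i] by (simp add: dvd_neg_div)
    show "p i j = (\<xi> ^ t) powi (b i j div int t)" for i j
    proof -
      have "(\<xi> ^ t) powi (b i j div int t) = \<xi> powi (int t * (b i j div int t))"
        by (simp add: power_int_mult)
      then show ?thesis
        using t_dvd by (simp add: p)
    qed
  qed
  then have "l \<le> total_order" by (rule min)
  with dvd l(1) show ?thesis
    by (meson dvd_imp_le le_antisym)
qed

text \<open>Central monomials multiply without any twist, so the center carries the ordinary product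
  of monomials.\<close>

lemma sort_factor_central:
  assumes "\<And>i. row_order i dvd d i"
  shows "sort_factor p d e = 1"
  unfolding sort_factor_def
proof (intro prod.neutral ballI)
  fix i j
  have "ord i j dvd row_order i"
    unfolding row_order_def by (intro dvd_prodI) auto
  then have "ord j i dvd d i"
    using assms[of i] by (metis dvd_trans ord_commute)
  then show "p j i ^ (d i * e j) = 1"
    by (simp add: power_eq_one_iff_root_order root_of_unity)
qed

text \<open>The isomorphism sends the variable numbered \<open>en i\<close> to
  \<open>x_i^(row_order i)\<close>. It comes from an additive bijection of exponents, and it is
  multiplicative because sorting central monomials releases no scalar.\<close>

lemma center_regular: "center_regular p"
proof -
  define m where "m = card (UNIV :: 'n set)"
  obtain en :: "'n \<Rightarrow> nat" where en: "bij_betw en UNIV {..<m}"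
    using ex_bij_betw_finite_nat[of "UNIV :: 'n set"] unfolding m_def atLeast0LessThan by auto
  \<comment> \<open>The exponent vector in \<open>S\<close> of the image of the commutative monomial
    \<open>t\<close>.\<close>
  define K where "K = (\<lambda>t i. row_order i * Poly_Mapping.lookup t (en i))"
  let ?A = "{t :: nat \<Rightarrow>\<^sub>0 nat. Poly_Mapping.keys t \<subseteq> {..<m}}"
  let ?B = "{d. \<forall>i. row_order i dvd d i}"
  have K_dvd: "row_order i dvd K t i" for t i
    by (simp add: K_def)
  have K: "bij_betw K ?A ?B"
    unfolding bij_betw_def
  proof (intro conjI equalityI subsetI)
    show "inj_on K ?A"
    proof (rule inj_onI)
      fix t u assume tu: "t \<in> ?A" "u \<in> ?A" and "K t = K u"
      then have K_eq: "Poly_Mapping.lookup t (en i) = Poly_Mapping.lookup u (en i)" for i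
        by (simp add: K_def fun_eq_iff) (metis less_not_refl row_order_pos)
      show "t = u"
      proof (rule poly_mapping_eqI)
        fix k show "Poly_Mapping.lookup t k = Poly_Mapping.lookup u k"
        proof (cases "k < m")
          case True
          then obtain i where "k = en i"
            using en by (auto simp: bij_betw_def)
          then show ?thesis by (simp add: K_eq)
        next
          case False
          then have "k \<notin> Poly_Mapping.keys t" "k \<notin> Poly_Mapping.keys u"
            using tu by auto
          then show ?thesis by (simp add: in_keys_iff)
        qed
      qed
    qed
    show "d \<in> ?B" if "d \<in> K ` ?A" for d
      using that K_dvd by auto
    fix d assume d: "d \<in> ?B"
    \<comment> \<open>The preimage of \<open>d\<close> under \<open>K\<close>; the value 0 from
      \<open>m\<close> on keeps it within the \<open>m\<close> variables and its support
      finite.\<close>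
    define g where "g k = (if k < m then d (inv_into UNIV en k) div row_order (inv_into UNIV en k) else 0)" for k
    have "finite {k. g k \<noteq> 0}"
      by (rule finite_subset[of _ "{..<m}"]) (auto simp: g_def)
    then have lookup: "Poly_Mapping.lookup (Abs_poly_mapping g) = g"
      by simp
    show "d \<in> K ` ?A"
    proof (rule image_eqI)
      show "d = K (Abs_poly_mapping g)"
      proof
        fix i
        have "en i < m" "inv_into UNIV en (en i) = i"
          using en by (auto simp: bij_betw_def)
        then show "d i = K (Abs_poly_mapping g) i"
          using d by (simp add: K_def lookup) (simp add: g_def)
      qed
      show "Abs_poly_mapping g \<in> ?A"
        by (auto simp: in_keys_iff lookup g_def split: if_splits)
    qed
  qed
  define h :: "((nat \<Rightarrow>\<^sub>0 nat) \<Rightarrow>\<^sub>0 'k) \<Rightarrow> ('n, 'k) free_alg set"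
    where "h = (\<lambda>f. from_coord (rekey K f))"
  have K_add: "K (t + u) = (\<lambda>i. K t i + K u i)" for t u
    by (simp add: K_def lookup_add ring_distribs)
  have rekey_mult: "rekey K (f * g) = twisted_mult p (rekey K f) (rekey K g)"
    for f g :: "(nat \<Rightarrow>\<^sub>0 nat) \<Rightarrow>\<^sub>0 'k"
    by (rule biadditive_eqI[where F = "\<lambda>f g. rekey K (f * g)"
          and G = "\<lambda>f g. twisted_mult p (rekey K f) (rekey K g)"])
      (simp_all add: additive.intro ring_distribs additive.add[OF additive_rekey]
        additive.add[OF additive_twisted_mult_left] additive.add[OF additive_twisted_mult_right]
        mult_single pm_extend_single twisted_mult_single K_add sort_factor_central[OF K_dvd])
  \<comment> \<open>Centrality is purely a condition on the support, so relabelling exponents along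
    \<open>K\<close> already gives a bijection onto the center.\<close>
  have center: "ring_center S = {u \<in> carrier S. Poly_Mapping.keys (coord u) \<subseteq> ?B}"
    by (simp add: set_eq_iff mem_center_iff commutation_char_eq_one_iff subset_iff Ball_def)
  have bij: "bij_betw h {f. Poly_Mapping.keys f \<subseteq> ?A} (ring_center S)"
  proof -
    have "bij_betw from_coord {g. Poly_Mapping.keys g \<subseteq> ?B} (ring_center S)"
      by (rule bij_betw_byWitness[where f' = coord]) (auto simp: center)
    then show ?thesis
      using bij_betw_trans[OF bij_betw_rekey[OF K]] by (simp add: h_def comp_def)
  qed
  have h_carrier: "h f \<in> carrier S" for f
    by (simp add: h_def)
  have coord_h: "coord (h f) = rekey K f" for f
    by (simp add: h_def)
  have K_zero: "K 0 = (\<lambda>_. 0)"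
    by (simp add: K_def)
  have "h \<in> ring_iso (comm_poly_ring m) (S\<lparr>carrier := ring_center S\<rparr>)"
  proof (rule ring_iso_memI)
    have carrier: "carrier (comm_poly_ring m :: ((nat \<Rightarrow>\<^sub>0 nat) \<Rightarrow>\<^sub>0 'k) ring)
        = {f. Poly_Mapping.keys f \<subseteq> ?A}"
      by (auto simp: comm_poly_ring_def)
    show "bij_betw h (carrier (comm_poly_ring m)) (carrier (S\<lparr>carrier := ring_center S\<rparr>))"
      using bij by (simp add: carrier)
    then show "h f \<in> carrier (S\<lparr>carrier := ring_center S\<rparr>)" if "f \<in> carrier (comm_poly_ring m)" for f
      using that by (rule bij_betwE[THEN bspec])
    fix f g
    have "h (f * g) = h f \<otimes>\<^bsub>S\<^esub> h g"
      by (rule coord_inj) (simp_all add: h_carrier coord_h rekey_mult)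
    then show "h (f \<otimes>\<^bsub>comm_poly_ring m\<^esub> g) = h f \<otimes>\<^bsub>S\<lparr>carrier := ring_center S\<rparr>\<^esub> h g"
      by (simp add: comm_poly_ring_def)
    have "h (f + g) = h f \<oplus>\<^bsub>S\<^esub> h g"
      by (rule coord_inj) (simp_all add: h_carrier coord_h additive.add[OF additive_rekey])
    then show "h (f \<oplus>\<^bsub>comm_poly_ring m\<^esub> g) = h f \<oplus>\<^bsub>S\<lparr>carrier := ring_center S\<rparr>\<^esub> h g"
      by (simp add: comm_poly_ring_def)
  next
    have "h 1 = \<one>\<^bsub>S\<^esub>"
      by (rule coord_inj) (simp_all add: h_carrier coord_h pm_extend_single K_zero flip: single_one)
    then show "h \<one>\<^bsub>comm_poly_ring m\<^esub> = \<one>\<^bsub>S\<lparr>carrier := ring_center S\<rparr>\<^esub>"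
      by (simp add: comm_poly_ring_def)
  qed
  moreover have "h (Poly_Mapping.single 0 c) = skew_scalar p c" for c
    by (rule coord_inj)
      (simp_all add: h_carrier coord_h pm_extend_single K_zero coord_skew_scalar,
        simp add: skew_scalar_def)
  ultimately show ?thesis
    unfolding center_regular_def is_polynomial_algebra_def by blast
qed

end

theorem theorem0p9:
  fixes p :: "'n::{finite,linorder} \<Rightarrow> 'n \<Rightarrow> 'k::field_char_0"
    and \<xi> :: 'k and l :: nat and b :: "'n \<Rightarrow> 'n \<Rightarrow> int"
  assumes "mult_antisymmetric p"
    and "\<forall>i j. root_of_unity (p i j)"
    and "minimal_exponent_data p l \<xi> b"
    and "l > 1"
    and "\<not> cring (skew_poly_ring p)"
    and "orders_pairwise_coprime p"
  shows "center_regular p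
    \<and> (\<forall>i. center_gcd p i = (\<Prod>j\<in>UNIV. root_order (p i j))
          \<and> (\<Prod>j\<in>UNIV. root_order (p i j)) = (\<Prod>j\<in>UNIV - {i}. root_order (p i j)))
    \<and> card (conj_group p) = l ^ 2"
proof -
  interpret coprime_skew_setting p
    using assms by unfold_locales auto
  \<comment> \<open>The factor at \<open>j = i\<close> is the order of
    \<open>p i i = 1\<close>.\<close>
  have "(\<Prod>j\<in>UNIV. root_order (p i j)) = (\<Prod>j\<in>UNIV - {i}. root_order (p i j))" for i
    by (subst prod.remove[of UNIV i]) simp_all
  then show ?thesis
    using center_regular center_gcd_eq card_conj_group prod_row_order total_order_eq[OF assms(3)]
    by (simp add: row_order_def)
qed

end
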